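(* Let $k$ and $\ell$ be positive integers and write $m:=2^{\mathrm{ord}_2(\gcd(k,\ell))}$. Suppose that $q:=2^k$ and $Q:=2^\ell$ satisfy $\gcd(Q+1,q+1)=1$. Write $A(X):=1+aX+bX^v+cX^u$ where $a,b,c\in\mathbb{F}_{q^2}$ and $u,v$ are positive integers such that $u(Q+1)\equiv 1\pmod{q+1}$ and $v(Q+1)\equiv Q\pmod{q+1}$. Then $f(X):=XA(X^{q-1})$ permutes $\mathbb{F}_{q^2}$ if and only if all of the following hold: (1) $e:=1+a^{q+1}+b^{q+1}+c^{q+1}$ is nonzero; (2) $(a^qb+c^q)^Q=e^{Q-1}(a^qc+b^q)$; (3) $\mathrm{Tr}_{\mathbb{F}_q/\mathbb{F}_{2^m}}\Bigl(\frac{b^{q+1}+c^{q+1}}{e}\Bigr)=0$.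
   Context: For a positive integer $n$, $\mathrm{ord}_2(n)$ is the largest integer $i\ge0$ with $2^i\mid n$. A polynomial permutes $\mathbb{F}_{q^2}$ if it induces a bijection of $\mathbb{F}_{q^2}$. $\mathrm{Tr}_{\mathbb{F}_q/\mathbb{F}_{2^m}}$ is the trace map (note $m\mid k$). *)

theory Defs
  imports "HOL-Computational_Algebra.Computational_Algebra" "HOL-Number_Theory.Cong" "HOL-Library.Cardinality"
begin

text \<open>
  The trace map from the field with \<open>r ^ n\<close> elements to its subfield with \<open>r\<close> elements:
  the sum of the conjugates \<open>x\<close>, \<open>x ^ r\<close>, ..., \<open>x ^ (r ^ (n - 1))\<close>.  The ambient type may be
  a larger field; the value is meaningful for arguments with \<open>x ^ (r ^ n) = x\<close>, i.e. those in the
  subfield with \<open>r ^ n\<close> elements.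
\<close>

definition finite_field_trace :: "nat \<Rightarrow> nat \<Rightarrow> 'a::field \<Rightarrow> 'a" where
  "finite_field_trace r n x = (\<Sum>i<n. x ^ (r ^ i))"

definition permutation_polynomial :: "'a::{field,finite} poly \<Rightarrow> bool" where
  "permutation_polynomial f \<longleftrightarrow> bij (poly f)"

end

theory Submission
  imports Defs
begin

text \<open>
  Write \<open>x\<^sup>*\<close> for \<open>x\<^sup>q\<close>. Every nonzero \<open>X\<close> is \<open>g y\<^sup>Q\<^sup>+\<^sup>1\<close> with \<open>g\<close> in the small field, and
  \<open>f(X) = g F(y)\<close> for \<open>F(y) = y\<^sup>Q\<^sup>+\<^sup>1 + c y\<^sup>Q y\<^sup>* + b (y\<^sup>*)\<^sup>Q y + a (y\<^sup>*)\<^sup>Q\<^sup>+\<^sup>1\<close>. Hence \<open>f\<close> permutes the field iff \<open>F\<close> is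
  injective on the projective line, that is, \<open>T(F x, F y) \<noteq> 0\<close> whenever \<open>T(x, y) \<noteq> 0\<close>, where
  \<open>T(x, y) = x y\<^sup>* + x\<^sup>* y\<close>. If \<open>e \<noteq> 0\<close>, then \<open>T(F x, F y)\<close> equals \<open>e T(x, y)\<^sup>Q\<^sup>+\<^sup>1\<close> times
  \<open>1 + w + \<rho>\<^sub>t(x, y)\<^sup>Q + \<rho>\<^sub>s(x, y)\<close>, where \<open>\<rho>\<^sub>s(x, y) = (x y\<^sup>* + tr(s x y)) / T(x, y)\<close> and
  \<open>w = (b\<^sup>q\<^sup>+\<^sup>1 + c\<^sup>q\<^sup>+\<^sup>1) / e\<close>; condition (2) says \<open>s = t\<close>. In that case the values of \<open>\<rho>\<^sub>s\<close> are exactly the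
  elements of trace 1, so injectivity means that \<open>\<phi>\<^sup>Q + \<phi> = 1 + w\<close> has no solution of trace 1, which
  is condition (3). Conversely, injectivity forces \<open>e \<noteq> 0\<close> and \<open>s = t\<close>: if \<open>tr(t z) = 1\<close> has a
  solution of norm 1, then \<open>tr(s z) = 1\<close> must have the same solutions; otherwise one can reduce to
  \<open>t = 0\<close>, where summing a degree \<open>Q + 1\<close> rational function over the norm-1 elements gives \<open>s = 0\<close>.
\<close>

section \<open>Finite fields and the additive form of Hilbert 90\<close>

lemma power_card_minus_one:
  fixes x :: "'a :: {field, finite}"
  assumes "x \<noteq> 0"
  shows "x ^ (CARD('a) - 1) = 1"
proof -
  have "(\<Prod>y\<in>UNIV - {0}. x * y) = \<Prod>(UNIV - {0})"
    by (rule prod.reindex_bij_witness[of _ "\<lambda>y. y / x" "\<lambda>y. x * y"]) (use assms in auto)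
  moreover have "(\<Prod>y\<in>UNIV - {0}. x * y) = x ^ (CARD('a) - 1) * \<Prod>(UNIV - {0::'a})"
    by (simp add: prod.distrib)
  ultimately show ?thesis
    by simp
qed

lemma power_card:
  fixes x :: "'a :: {field, finite}"
  shows "x ^ CARD('a) = x"
proof (cases "x = 0")
  case False
  have "x ^ CARD('a) = x * x ^ (CARD('a) - 1)"
    by (metis Suc_diff_1 finite_UNIV_card_ge_0 finite power_Suc)
  then show ?thesis
    using power_card_minus_one[OF False] by simp
qed (simp add: zero_power)

text \<open>Translation by 1 permutes the field, so summing all elements shows that the cardinality
  vanishes in the field.\<close>

lemma CHAR_eq_2:
  assumes "CARD('a :: {field, finite}) = 2 ^ n"
  shows "CHAR('a) = 2"
proof -
  have pr: "prime CHAR('a)"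
    by (simp add: prime_CHAR_semidom finite_imp_CHAR_pos)
  have "sum (\<lambda>x. x) (UNIV :: 'a set) = (\<Sum>x\<in>UNIV. x + 1)"
    by (rule sum.reindex_bij_witness[of _ "\<lambda>x. x + 1" "\<lambda>x. x - 1"]) auto
  also have "\<dots> = (\<Sum>x\<in>UNIV. x) + of_nat CARD('a)"
    by (simp add: sum.distrib)
  finally have "of_nat CARD('a) = (0 :: 'a)"
    by simp
  then have "CHAR('a) dvd 2 ^ n"
    unfolding assms by (simp only: of_nat_eq_0_iff_char_dvd)
  then have "CHAR('a) dvd 2"
    using pr prime_dvd_power by blast
  then show ?thesis
    using pr primes_dvd_imp_eq two_is_prime_nat by blast
qed

lemma card_roots_le:
  fixes p :: "'a :: {field, finite} poly"
  assumes "p \<noteq> 0" "degree p \<le> n" "\<And>x. x \<in> S \<Longrightarrow> poly p x = 0"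
  shows "card S \<le> n"
proof -
  have "card S \<le> card {x. poly p x = 0}"
    using assms(3) by (intro card_mono) auto
  also have "\<dots> \<le> n"
    using card_poly_roots_bound[OF assms(1)] assms(2) by simp
  finally show ?thesis .
qed

text \<open>By counting: the image of \<open>L\<close> lies in the kernel \<open>Z\<close> of the
  trace, which has at most \<open>r ^ (n - 1)\<close> elements by degree. The fibres of
  \<open>L\<close> have at most \<open>r\<close> elements, so the image is at least as large as
  \<open>Z\<close>.\<close>

lemma additive_hilbert90:
  fixes c :: "'a :: {field, finite}"
  assumes card: "CARD('a) = r ^ n" and r: "r = 2 ^ d" "d > 0" "n > 0"
    and c: "(\<Sum>i<n. c ^ (r ^ i)) = 0"
  shows "\<exists>x. x ^ r + x = c"
proof -
  have char: "CHAR('a) = 2"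
    using card r by (intro CHAR_eq_2[of "d * n"]) (simp add: power_mult)
  have r1: "r > 1"
    unfolding r using r by (intro one_less_power) auto
  define Z where "Z = {c :: 'a. (\<Sum>i<n. c ^ (r ^ i)) = 0}"
  define L where "L = (\<lambda>x :: 'a. x ^ r + x)"
  have two: "x + x = 0" for x :: 'a
    using of_nat_CHAR[where 'a = 'a] char by (simp flip: mult_2)
  have frob: "(x + y) ^ (r ^ i) = x ^ (r ^ i) + y ^ (r ^ i)" for x y :: 'a and i
    by (rule freshmans_dream'[of _ "d * i"]) (auto simp: char r power_mult)
  have sub: "range L \<subseteq> Z"
  proof (clarify, unfold Z_def mem_Collect_eq)
    fix x
    have "(\<Sum>i<n. L x ^ (r ^ i)) = (\<Sum>i<n. x ^ (r ^ Suc i) - x ^ (r ^ i))"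
      unfolding L_def frob using two
      by (intro sum.cong) (auto simp flip: power_mult simp: eq_diff_eq add.assoc)
    also have "\<dots> = x ^ (r ^ n) - x"
      by (subst sum_lessThan_telescope) simp
    finally show "(\<Sum>i<n. L x ^ (r ^ i)) = 0"
      using power_card[of x] card by simp
  qed
  have Z: "card Z \<le> r ^ (n - 1)"
  proof (rule card_roots_le)
    let ?p = "\<Sum>i<n. monom 1 (r ^ i) :: 'a poly"
    have "coeff ?p 1 = (\<Sum>i<n. if i = 0 then 1 else 0)"
      unfolding coeff_sum using r1 by (intro sum.cong) (auto simp: power_eq_1_iff)
    also have "\<dots> = 1"
      using r by (simp add: sum.delta)
    finally show "?p \<noteq> 0"
      by auto
    show "degree ?p \<le> r ^ (n - 1)"
      using r1 by (intro degree_sum_le) (auto simp: degree_monom_eq intro!: power_increasing)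
    show "poly ?p x = 0" if "x \<in> Z" for x
      using that by (simp add: Z_def poly_sum poly_monom)
  qed
  have "r ^ n = card (\<Union>y\<in>range L. {x. L x = y})"
    using card by (simp add: UNION_singleton_eq_range flip: card)
      (metis (mono_tags, lifting) UNIV_eq_I UN_I mem_Collect_eq rangeI)
  also have "\<dots> \<le> (\<Sum>y\<in>range L. card {x. L x = y})"
    by (rule card_UN_le) simp
  also have "\<dots> \<le> (\<Sum>y\<in>range L. r)"
  proof (rule sum_mono)
    fix y :: 'a
    let ?p = "monom 1 r + monom 1 1 - [:y:]"
    have "coeff ?p r = 1"
      using r1 by (simp add: coeff_pCons split: nat.split)
    then have "?p \<noteq> 0"
      by (metis coeff_0 zero_neq_one)
    moreover have "degree ?p \<le> r"
      using r1 by (intro degree_diff_le degree_add_le) (auto simp: degree_monom_eq)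
    ultimately show "card {x. L x = y} \<le> r"
      by (rule card_roots_le) (simp add: poly_monom L_def)
  qed
  finally have "r * r ^ (n - 1) \<le> r * card (range L)"
    using r by (simp add: power_eq_if mult.commute)
  then have "range L = Z"
    using Z r1 sub by (intro card_seteq) auto
  then show ?thesis
    using c unfolding Z_def L_def by (metis (mono_tags, lifting) imageE mem_Collect_eq)
qed

lemma sum_lessThan_add:
  fixes f :: "nat \<Rightarrow> 'a :: comm_monoid_add"
  shows "(\<Sum>i<m + n. f i) = (\<Sum>i<m. f i) + (\<Sum>i<n. f (m + i))"
  by (induction n) (simp_all add: add_ac)

text \<open>Serves to show that \<open>k div m\<close> and \<open>l div m\<close> are not both
  odd.\<close>

lemma one_plus_power_dvd:
  fixes r :: nat assumes "odd n" shows "r + 1 dvd r ^ n + 1"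
proof -
  have "[int r = - 1] (mod (int r + 1))"
    by (simp add: cong_iff_dvd_diff)
  then have "[int r ^ n = - 1] (mod (int r + 1))"
    using cong_pow[of "int r" "- 1" "int r + 1" n] assms by simp
  then have "int (r + 1) dvd int (r ^ n + 1)"
    by (simp add: cong_iff_dvd_diff add.commute)
  then show ?thesis
    by (simp only: int_dvd_int_iff)
qed

subsection \<open>Quadratic extensions in characteristic two\<close>

text \<open>Conjugation \<open>cj\<close> is a parameter, so that it stays opaque to the simplifier
  and becomes a power only through \<open>cj_eq\<close>.\<close>

locale quadratic_extension =
  fixes k l q Q :: nat and cj :: "'a :: {field, finite} \<Rightarrow> 'a"
  assumes k: "k > 0" and l: "l > 0" and q: "q = 2 ^ k" and Q: "Q = 2 ^ l"
    and coprime_Q_q: "coprime (Q + 1) (q + 1)"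
    and card: "CARD('a) = q\<^sup>2" and cj_eq: "cj x = x ^ q"
begin

definition tr :: "'a \<Rightarrow> 'a" where "tr x = x + cj x"
text \<open>An alternating form over the fixed field of \<open>cj\<close>. For nonzero
  \<open>x\<close> and \<open>y\<close> it vanishes exactly when they give the same point of the
  projective line.\<close>

definition T :: "'a \<Rightarrow> 'a \<Rightarrow> 'a" where "T x y = x * cj y + cj x * y"
definition rho :: "'a \<Rightarrow> 'a \<Rightarrow> 'a \<Rightarrow> 'a"
  where "rho s x y = (x * cj y + tr (s * x * y)) / T x y"

lemma CHAR_2: "CHAR('a) = 2"
  using card by (intro CHAR_eq_2[of "k * 2"]) (simp add: q power_mult)

lemma two_eq_0 [simp]: "(2 :: 'a) = 0"
  using of_nat_CHAR[where 'a = 'a] by (simp add: CHAR_2)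

lemma add_self [simp]: "x + x = (0 :: 'a)"
  using mult_2[of x] by simp

lemma add_self_left [simp]: "x + (x + y) = (y :: 'a)"
  by (simp flip: add.assoc)

lemma uminus_eq [simp]: "- x = (x :: 'a)"
  by (simp add: minus_unique)

lemma minus_eq [simp]: "x - y = x + (y :: 'a)"
  using diff_conv_add_uminus[of x y] by simp

lemma add_eq_0_iff_eq: "x + y = 0 \<longleftrightarrow> x = (y :: 'a)"
  by (metis add_self add_self_left add_0_right)

lemma frobenius_add: "(x + y :: 'a) ^ (2 ^ n) = x ^ (2 ^ n) + y ^ (2 ^ n)"
  by (rule freshmans_dream'[where n = n]) (simp_all add: CHAR_2)

lemma Q_add: "(x + y :: 'a) ^ Q = x ^ Q + y ^ Q"
  unfolding Q by (rule frobenius_add)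

lemma Q_pos [simp]: "Q > 0"
  by (simp add: Q)

lemma zero_Q [simp]: "(0 :: 'a) ^ Q = 0"
  by (simp add: zero_power)

lemma q_ge_2: "q \<ge> 2"
  using k power_increasing[of 1 k "2 :: nat"] by (simp add: q)

lemma cj_add [simp]: "cj (x + y) = cj x + cj y"
  unfolding cj_eq q by (rule frobenius_add)

lemma cj_mult [simp]: "cj (x * y) = cj x * cj y"
  by (simp add: cj_eq power_mult_distrib)

lemma cj_divide [simp]: "cj (x / y) = cj x / cj y"
  by (simp add: cj_eq power_divide)

lemma cj_0 [simp]: "cj 0 = 0" and cj_1 [simp]: "cj 1 = 1"
  using q_ge_2 by (simp_all add: cj_eq)

lemma cj_power [simp]: "cj (x ^ n) = cj x ^ n"
  by (simp add: cj_eq mult.commute flip: power_mult)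

lemma cj_cj [simp]: "cj (cj x) = x"
  using power_card[of x] by (simp add: cj_eq card power2_eq_square flip: power_mult)

lemma cj_eq_0_iff [simp]: "cj x = 0 \<longleftrightarrow> x = 0"
  by (metis cj_0 cj_cj)

lemma Q_root: "\<exists>y. y ^ Q = (x :: 'a)"
proof -
  have "inj (\<lambda>y :: 'a. y ^ Q)"
    by (rule injI) (metis Q_add Q_pos add_eq_0_iff_eq power_eq_0_iff)
  then have "surj (\<lambda>y :: 'a. y ^ Q)"
    by (simp add: finite_UNIV_inj_surj)
  then show ?thesis
    by (metis surjD)
qed

lemma Q_inj: "x ^ Q = y ^ Q \<longleftrightarrow> x = (y :: 'a)"
  by (metis Q_add Q_pos add_eq_0_iff_eq power_eq_0_iff)

lemma cj_T [simp]: "cj (T x y) = T x y"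
  by (simp add: T_def mult_ac add_ac)

lemma cj_tr [simp]: "cj (tr x) = tr x"
  by (simp add: tr_def add_ac)

text \<open>The trace is a polynomial function of degree \<open>q\<close>, so it does not vanish on
  all \<open>q\<^sup>2\<close> elements; dividing by a nonzero value normalises it to 1.\<close>

lemma trace_one: obtains \<theta> where "cj \<theta> = \<theta> + 1"
proof -
  have "\<exists>x. tr x \<noteq> 0"
  proof (rule ccontr)
    assume *: "\<nexists>x. tr x \<noteq> 0"
    let ?p = "monom 1 q + monom 1 1 :: 'a poly"
    have "card (UNIV :: 'a set) \<le> q"
    proof (rule card_roots_le)
      have "coeff ?p q = 1"
        using q_ge_2 by auto
      then show "?p \<noteq> 0"
        by (metis coeff_0 zero_neq_one)
      show "degree ?p \<le> q"
        using q_ge_2 by (intro degree_add_le) (auto simp: degree_monom_eq)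
      show "poly ?p x = 0" for x
        using * by (simp add: poly_monom tr_def cj_eq add.commute)
    qed
    then show False
      using q_ge_2 by (simp add: card power2_eq_square)
  qed
  then obtain x where x: "tr x \<noteq> 0"
    by blast
  then have "cj (x / tr x) = x / tr x + 1"
    by (simp add: field_simps) (simp add: tr_def add_ac)
  then show ?thesis
    using that by blast
qed

lemma T_eq_0: assumes "T x y = 0" "y \<noteq> 0" shows "cj (x / y) = x / y"
  using assms by (simp add: T_def add_eq_0_iff_eq field_simps)

lemma T_nondegenerate: assumes "y \<noteq> 0" obtains x where "T x y \<noteq> 0"
proof -
  obtain \<theta> where \<theta>: "cj \<theta> = \<theta> + 1"
    by (rule trace_one)
  have "T (\<theta> * y) y = y * cj y"
    by (simp add: T_def \<theta> algebra_simps)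
  then show ?thesis
    using that assms by (metis cj_eq_0_iff mult_eq_0_iff)
qed

subsection \<open>The unit circle\<close>

definition unit_circle :: "'a set" where "unit_circle = {z. z * cj z = 1}"

lemma unit_circleD: "z \<in> unit_circle \<Longrightarrow> z \<noteq> 0" "z \<in> unit_circle \<Longrightarrow> cj z = 1 / z"
  by (auto simp: unit_circle_def eq_divide_eq mult.commute)

lemma unit_circle_iff: "z \<in> unit_circle \<longleftrightarrow> z ^ (q + 1) = 1"
  by (simp add: unit_circle_def cj_eq)

text \<open>The upper bound is a degree bound. For the lower bound, \<open>cj x / x\<close> maps the
  nonzero elements to the circle with fibres of size at most \<open>q - 1\<close>.\<close>

lemma card_unit_circle: "card unit_circle = q + 1"
proof (rule antisym)
  let ?p = "monom 1 (q + 1) - 1 :: 'a poly"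
  have "coeff ?p (q + 1) = 1"
    by simp
  then have p: "?p \<noteq> 0"
    by (metis coeff_0 zero_neq_one)
  have "degree ?p \<le> q + 1"
    by (intro degree_diff_le) (auto simp: degree_monom_eq)
  with p show "card unit_circle \<le> q + 1"
    by (rule card_roots_le) (simp add: unit_circle_iff poly_monom)
  define g where "g = (\<lambda>x. cj x / x)"
  have "q\<^sup>2 - 1 = card (UNIV - {0 :: 'a})"
    by (simp add: card)
  also have "\<dots> \<le> card (\<Union>y\<in>unit_circle. {x. x \<noteq> 0 \<and> g x = y})"
  proof (rule card_mono)
    have "g x \<in> unit_circle" if "x \<noteq> 0" for x
      using that by (simp add: g_def unit_circle_def)
    then show "UNIV - {0} \<subseteq> (\<Union>y\<in>unit_circle. {x. x \<noteq> 0 \<and> g x = y})"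
      by blast
  qed simp
  also have "\<dots> \<le> (\<Sum>y\<in>unit_circle. card {x. x \<noteq> 0 \<and> g x = y})"
    by (rule card_UN_le) simp
  also have "\<dots> \<le> (\<Sum>y\<in>unit_circle. q - 1)"
  proof (rule sum_mono)
    fix y :: 'a
    let ?p = "monom 1 (q - 1) - [:y:]"
    have "coeff ?p (q - 1) = 1"
      using q_ge_2 by (simp add: coeff_pCons split: nat.split)
    then have "?p \<noteq> 0"
      by (metis coeff_0 zero_neq_one)
    moreover have "degree ?p \<le> q - 1"
      by (intro degree_diff_le) (auto simp: degree_monom_eq)
    moreover have "poly ?p x = 0" if "x \<noteq> 0" "g x = y" for x
    proof -
      have "x ^ (q - 1) * x = x ^ q"
        using q_ge_2 by (metis One_nat_def Suc_diff_le diff_Suc_Suc diff_zero numeral_2_eq_2 power_Suc2 Suc_leD)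
      then show ?thesis
        using that by (auto simp: poly_monom g_def cj_eq field_simps add_eq_0_iff_eq)
    qed
    ultimately show "card {x. x \<noteq> 0 \<and> g x = y} \<le> q - 1"
      by (intro card_roots_le) auto
  qed
  finally have "(q + 1) * (q - 1) \<le> card unit_circle * (q - 1)"
    by (cases q) (simp_all add: power2_eq_square algebra_simps)
  then show "q + 1 \<le> card unit_circle"
    using q_ge_2 by (simp only: mult_le_cancel2)
qed

lemma unit_circle_sqrt:
  assumes "z \<in> unit_circle" obtains x where "x \<in> unit_circle" "x * x = z"
proof -
  \<comment> \<open>The exponent is the inverse of 2 modulo \<open>q + 1\<close>: its double is
    \<open>q + 2\<close>.\<close>
  define x where "x = z ^ (2 ^ (k - 1) + 1)"
  have "2 ^ (k - 1) + 2 ^ (k - 1) = q"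
    using k unfolding q by (cases k) auto
  then have "x * x = z ^ (q + 1) * z"
    unfolding x_def power_add[symmetric] power_Suc2[symmetric] by (intro arg_cong[of _ _ "power z"]) simp
  then have xx: "x * x = z"
    using assms by (simp only: unit_circle_iff mult_1)
  have "x ^ (q + 1) = (z ^ (q + 1)) ^ (2 ^ (k - 1) + 1)"
    unfolding x_def power_mult[symmetric] by (simp only: mult.commute)
  then have "x \<in> unit_circle"
    using assms by (simp only: unit_circle_iff power_one)
  then show ?thesis
    using xx that by blast
qed

text \<open>Scaling by a point \<open>g\<close> with \<open>g ^ j \<noteq> 1\<close> permutes the
  circle and multiplies the sum by \<open>g ^ j\<close>.\<close>

lemma sum_unit_circle:
  assumes "\<not> (q + 1) dvd j" shows "(\<Sum>z\<in>unit_circle. z ^ j) = 0"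
proof -
  have "\<exists>g\<in>unit_circle. g ^ j \<noteq> 1"
  proof (rule ccontr)
    assume *: "\<not> ?thesis"
    define i where "i = j mod (q + 1)"
    have i: "0 < i" "i < q + 1"
      using assms by (simp_all add: i_def dvd_eq_mod_eq_0)
    have "card unit_circle \<le> i"
    proof (rule card_roots_le)
      let ?p = "monom 1 i - 1 :: 'a poly"
      have "coeff ?p i = 1"
        using i by simp
      then show "?p \<noteq> 0"
        by (metis coeff_0 zero_neq_one)
      show "degree ?p \<le> i"
        by (intro degree_diff_le) (auto simp: degree_monom_eq)
      fix z assume z: "z \<in> unit_circle"
      have "z ^ j = (z ^ (q + 1)) ^ (j div (q + 1)) * z ^ i"
        unfolding i_def power_mult[symmetric] power_add[symmetric] by (simp only: mult_div_mod_eq)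
      then have "z ^ i = 1"
        using * z unfolding unit_circle_iff[of z] by (metis power_one mult_1 z)
      then show "poly ?p z = 0"
        by (simp add: poly_monom)
    qed
    then show False
      using i card_unit_circle by simp
  qed
  then obtain g where g: "g \<in> unit_circle" "g ^ j \<noteq> 1"
    by blast
  have "(\<Sum>z\<in>unit_circle. z ^ j) = (\<Sum>z\<in>unit_circle. (g * z) ^ j)"
    by (rule sum.reindex_bij_witness[of _ "\<lambda>z. g * z" "\<lambda>z. z / g"])
      (use g in \<open>auto simp: unit_circle_def mult_ac\<close>)
  also have "\<dots> = g ^ j * (\<Sum>z\<in>unit_circle. z ^ j)"
    by (simp add: power_mult_distrib sum_distrib_left)
  finally show ?thesis
    using g by simp
qed

lemma sum_unit_circle_dvd:
  assumes "(q + 1) dvd j" shows "(\<Sum>z\<in>unit_circle. z ^ j) = 1"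
proof -
  have "z ^ j = 1" if "z \<in> unit_circle" for z
    using that assms unfolding unit_circle_iff by (metis dvd_def power_mult power_one)
  then have "(\<Sum>z\<in>unit_circle. z ^ j) = of_nat (q + 1)"
    by (simp add: card_unit_circle)
  also have "\<dots> = (1 :: 'a)"
    using k by (simp add: q power_0_left)
  finally show ?thesis .
qed

subsection \<open>Twisted forms\<close>

text \<open>The map to be studied is \<open>form 1 c b a\<close>. The leading coefficient stays free
  because an auxiliary form needs \<open>1 + w\<close> there.\<close>

definition form :: "'a \<Rightarrow> 'a \<Rightarrow> 'a \<Rightarrow> 'a \<Rightarrow> 'a \<Rightarrow> 'a" where
  "form A B C E x = A * x ^ Q * x + B * x ^ Q * cj x + C * cj x ^ Q * x + E * cj x ^ Q * cj x"

text \<open>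
  Up to conjugation, the coefficients on the right are \<open>2 \<times> 2\<close> minors, or sums of two of them, of the
  matrix with rows \<open>(A, B, C, E)\<close> and \<open>(cj E, cj C, cj B, cj A)\<close>, the coefficients of the form and of
  its conjugate. Hence they satisfy a Pluecker relation.
\<close>

lemma T_form:
  "T (form A B C E x) (form A B C E y) =
     (A * cj A + B * cj B + C * cj C + E * cj E) * tr ((x * cj y) ^ Q * (x * cj y))
     + (B * cj B + C * cj C) * (T x y ^ Q * T x y)
     + T x y * tr ((A * cj C + B * cj E) * (x * y) ^ Q)
     + T x y ^ Q * tr ((A * cj B + C * cj E) * (x * y))"
  unfolding T_def form_def tr_def
  by (simp add: Q_add power_mult_distrib) (simp add: algebra_simps)

lemma pluecker:
  fixes A B C E :: 'a
  shows "(A * cj B + C * cj E) * cj (A * cj B + C * cj E) + (A * cj C + B * cj E) * cj (A * cj C + B * cj E)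
     = (B * cj B + C * cj C) * ((A * cj A + B * cj B + C * cj C + E * cj E) + (B * cj B + C * cj C))"
  by (simp add: algebra_simps)

text \<open>In \<open>T_form\<close>, replace the conjugate of \<open>x * cj y\<close> by
  \<open>x * cj y + T x y\<close>. The terms then group into the numerators of
  \<open>rho t x y ^ Q\<close> and \<open>rho s x y\<close>.\<close>

lemma T_form_eq_rho:
  assumes e: "e = A * cj A + B * cj B + C * cj C + E * cj E"
    and w: "e * w = B * cj B + C * cj C"
    and t: "e * t ^ Q = A * cj C + B * cj E" and s: "e * s = A * cj B + C * cj E"
    and nz: "T x y \<noteq> 0"
  shows "T (form A B C E x) (form A B C E y)
    = e * (T x y ^ Q * T x y) * (1 + w + rho t x y ^ Q + rho s x y)"
proof -
  have ce: "cj e = e"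
    unfolding e by (simp add: mult_ac)
  have "T (form A B C E x) (form A B C E y) =
     e * (tr ((x * cj y) ^ Q * (x * cj y)) + w * (T x y ^ Q * T x y)
     + T x y * tr (t ^ Q * (x * y) ^ Q) + T x y ^ Q * tr (s * (x * y)))"
    unfolding T_form t[symmetric] s[symmetric] e[symmetric] w[symmetric]
    by (simp add: tr_def ce algebra_simps)
  also have "tr ((x * cj y) ^ Q * (x * cj y))
    = T x y ^ Q * T x y + (x * cj y) ^ Q * T x y + T x y ^ Q * (x * cj y)"
    unfolding T_def tr_def by (simp add: Q_add power_mult_distrib) (simp add: algebra_simps)
  also have "tr (t ^ Q * (x * y) ^ Q) = tr (t * x * y) ^ Q"
    unfolding tr_def by (simp add: Q_add power_mult_distrib mult_ac)
  also have "e * (T x y ^ Q * T x y + (x * cj y) ^ Q * T x y + T x y ^ Q * (x * cj y)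
       + w * (T x y ^ Q * T x y) + T x y * tr (t * x * y) ^ Q + T x y ^ Q * tr (s * (x * y)))
     = e * (T x y ^ Q * T x y + w * (T x y ^ Q * T x y)
       + T x y * (x * cj y + tr (t * x * y)) ^ Q + T x y ^ Q * (x * cj y + tr (s * x * y)))"
    by (simp add: Q_add) (simp add: algebra_simps)
  also have "\<dots> = e * (T x y ^ Q * T x y) * (1 + w + rho t x y ^ Q + rho s x y)"
    unfolding rho_def power_divide using nz by (simp add: field_simps)
  finally show ?thesis .
qed

lemma tr_mult_fixed: "cj g = g \<Longrightarrow> tr (g * x) = g * tr x"
  by (simp add: tr_def algebra_simps)

lemma rho_linear:
  assumes y: "y \<in> unit_circle" and x: "cj \<xi> = \<xi> + 1"
  shows "T (\<xi> * y) y = 1" "rho s (\<xi> * y) y = \<xi> + tr (s * \<xi> * (y * y))"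
proof -
  have y: "y * cj y = 1"
    using y by (simp add: unit_circle_def)
  have "T (\<xi> * y) y = (\<xi> + cj \<xi>) * (y * cj y)"
    by (simp add: T_def algebra_simps)
  then show T: "T (\<xi> * y) y = 1"
    unfolding y x by simp
  have "\<xi> * y * cj y = \<xi>"
    using y by (simp add: mult.assoc)
  then show "rho s (\<xi> * y) y = \<xi> + tr (s * \<xi> * (y * y))"
    by (simp add: rho_def T mult_ac)
qed

section \<open>The avoided equation and the values of \<open>rho\<close>\<close>

text \<open>Projective injectivity of a form with nonzero \<open>e\<close>, stripped of the nonzero
  factor in \<open>T_form_eq_rho\<close>.\<close>

definition avoids :: "'a \<Rightarrow> 'a \<Rightarrow> 'a \<Rightarrow> bool" where
  "avoids w t s \<longleftrightarrow> (\<forall>x y. T x y \<noteq> 0 \<longrightarrow> 1 + w + rho t x y ^ Q + rho s x y \<noteq> 0)"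

text \<open>
  For fixed \<open>y\<close> on the unit circle and \<open>x = (\<theta> + p) y\<close> with \<open>p\<close> in the small field, the avoided
  equation reads \<open>((1 + tr (t z)) p)\<^sup>Q + (1 + tr (s z)) p = const\<close> with \<open>z = y\<^sup>2\<close>; it has a root if exactly
  one of the two factors vanishes.
\<close>

lemma avoids_same_zeros:
  assumes av: "avoids w t s" and w: "cj w = w" and z: "z \<in> unit_circle"
  shows "tr (t * z) = 1 \<longleftrightarrow> tr (s * z) = 1"
proof -
  obtain y where y: "y \<in> unit_circle" "y * y = z"
    using unit_circle_sqrt[OF z] by blast
  obtain \<theta> where \<theta>: "cj \<theta> = \<theta> + 1"
    by (rule trace_one)
  have rho: "rho r ((\<theta> + p) * y) y = \<theta> + tr (r * \<theta> * z) + p * (1 + tr (r * z))"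
    if "cj p = p" for r p
    using rho_linear(2)[OF y(1), of "\<theta> + p" r] that tr_mult_fixed[OF that, of "r * z"]
    by (simp add: \<theta> y tr_def algebra_simps)
  have ne: "1 + w + (\<theta> + tr (t * \<theta> * z) + p * (1 + tr (t * z))) ^ Q
      + (\<theta> + tr (s * \<theta> * z) + p * (1 + tr (s * z))) \<noteq> 0" if "cj p = p" for p
  proof -
    have "cj (\<theta> + p) = \<theta> + p + 1"
      using that \<theta> by (simp add: add_ac)
    then have "T ((\<theta> + p) * y) y = 1"
      by (rule rho_linear(1)[OF y(1)])
    then have "1 + w + rho t ((\<theta> + p) * y) y ^ Q + rho s ((\<theta> + p) * y) y \<noteq> 0"
      using av unfolding avoids_def by simp
    then show ?thesis
      unfolding rho[OF that] .
  qed
  show ?thesis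
  proof (rule ccontr)
    assume "\<not> ?thesis"
    then consider "tr (t * z) = 1" "tr (s * z) \<noteq> 1" | "tr (t * z) \<noteq> 1" "tr (s * z) = 1"
      by blast
    then show False
    proof cases
      case 1
      define \<kappa> where "\<kappa> = 1 + tr (s * z)"
      define X where "X = 1 + w + (\<theta> + tr (t * \<theta> * z)) ^ Q + (\<theta> + tr (s * \<theta> * z))"
      have "\<kappa> \<noteq> 0"
        using 1 by (simp add: \<kappa>_def add_eq_0_iff_eq)
      \<comment> \<open>Conjugation adds 1 to \<open>\<theta> ^ Q\<close> and to
        \<open>\<theta>\<close>, and the two cancel.\<close>
      have "cj (X / \<kappa>) = X / \<kappa>"
        by (simp add: X_def \<kappa>_def \<theta> w Q_add add_ac)
      from ne[OF this] show False
        using 1 \<open>\<kappa> \<noteq> 0\<close> by (simp flip: \<kappa>_def) (simp add: X_def add.assoc)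
    next
      case 2
      define \<kappa> where "\<kappa> = 1 + tr (t * z)"
      define X where "X = 1 + w + (\<theta> + tr (s * \<theta> * z))"
      have "\<kappa> \<noteq> 0"
        using 2 by (simp add: \<kappa>_def add_eq_0_iff_eq)
      \<comment> \<open>Here \<open>X\<close> contains only one \<open>\<theta>\<close>, so
        \<open>u\<close> has trace one and \<open>u + \<theta>\<close> lies in the small
        field.\<close>
      obtain u where u: "u ^ Q = X"
        using Q_root by blast
      have "cj u ^ Q = (u + 1) ^ Q"
        unfolding Q_add u cj_power[symmetric] by (simp add: X_def \<theta> w add_ac)
      then have cu: "cj u = u + 1"
        by (simp add: Q_inj)
      define p where "p = (u + (\<theta> + tr (t * \<theta> * z))) / \<kappa>"
      have "cj p = p"
        unfolding p_def by (simp add: \<kappa>_def \<theta> cu)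
      from ne[OF this] have "1 + w + (\<theta> + tr (t * \<theta> * z) + p * \<kappa>) ^ Q + (\<theta> + tr (s * \<theta> * z)) \<noteq> 0"
        using 2 by (simp add: \<kappa>_def)
      moreover have "\<theta> + tr (t * \<theta> * z) + p * \<kappa> = u"
        using \<open>\<kappa> \<noteq> 0\<close> by (simp add: p_def add_ac)
      ultimately show False
        using u X_def by (metis add.assoc add.commute add_self)
    qed
  qed
qed

text \<open>On the circle the trace condition is the quadratic
  \<open>t * z * z + z + cj t = 0\<close>. Its roots have sum \<open>1 / t\<close> and product
  \<open>cj t / t\<close>, so the second root is on the circle too.\<close>

lemma second_zero:
  assumes z: "z \<in> unit_circle" and t: "tr (t * z) = 1"
  shows "t \<noteq> 0" "z + 1 / t \<in> unit_circle"
proof -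
  show t0: "t \<noteq> 0"
    using t by (auto simp: tr_def)
  have z0: "z \<noteq> 0" "cj z = 1 / z"
    using unit_circleD[OF z] .
  have "t * z + cj t / z = 1"
    using t z0(2) by (simp add: tr_def)
  then have "t * z + 1 = t * z + (t * z + cj t / z)"
    by simp
  then have "t * z + 1 = cj t / z"
    by (simp only: add_self_left)
  then have "z + 1 / t = cj t / (t * z)"
    using t0 z0 by (simp add: field_simps)
  then show "z + 1 / t \<in> unit_circle"
    using t0 z0 by (simp add: unit_circle_def)
qed

text \<open>Both zeros of the quadratic for \<open>t\<close> are zeros for \<open>s\<close>. Their
  difference \<open>1 / t\<close> gives \<open>tr (s / t) = 0\<close>, so \<open>s / t\<close> lies
  in the small field, and comparing traces at \<open>z\<close> makes it 1.\<close>

lemma avoids_split: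
  assumes av: "avoids w t s" and w: "cj w = w" and z: "z \<in> unit_circle" and t: "tr (t * z) = 1"
  shows "t = s"
proof -
  note t0 = second_zero[OF z t]
  have 1: "tr (s * z) = 1"
    using avoids_same_zeros[OF av w z] t by simp
  have "tr (t * (z + 1 / t)) = 1"
    using t t0(1) by (simp add: tr_def algebra_simps)
  then have "tr (s * (z + 1 / t)) = 1"
    using avoids_same_zeros[OF av w t0(2)] by simp
  moreover have "tr (s * (z + 1 / t)) = tr (s * z) + tr (s / t)"
    by (simp add: tr_def distrib_left add_ac)
  ultimately have "tr (s / t) = 0"
    using 1 by simp
  then have "cj (s / t) = s / t"
    unfolding tr_def by (simp only: add_eq_0_iff_eq)
  from tr_mult_fixed[OF this, of "t * z"] have "s / t = 1"
    using 1 t t0(1) by simp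
  then show ?thesis
    using t0(1) by simp
qed

text \<open>The trace condition is quadratic in \<open>z\<close>, with at most two roots, while the
  circle has at least three points.\<close>

lemma zero_free_point:
  obtains z where "z \<in> unit_circle" "tr (s * z) \<noteq> 1"
proof (rule ccontr)
  note found = that
  assume *: "\<not> thesis"
  have all: "tr (s * z) = 1" if "z \<in> unit_circle" for z
    using found[OF that] * by blast
  have 1: "1 \<in> unit_circle"
    by (simp add: unit_circle_def)
  have "z \<in> {1, 1 + 1 / s}" if z: "z \<in> unit_circle" for z
  proof -
    have "s * z * z + z + cj s = 0" if "z \<in> unit_circle" for z
    proof -
      have "z * cj z = 1"
        using that by (simp add: unit_circle_def)
      then have "z * tr (s * z) = s * z * z + cj s"
        by (simp add: tr_def distrib_left mult_ac)
      then show ?thesis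
        unfolding all[OF that] by (simp add: add_ac)
    qed
    note this[OF z] this[OF 1]
    moreover have "(z + 1) * (s * (z + 1) + 1) = (s * z * z + z + cj s) + (s * 1 * 1 + 1 + cj s)"
      by (simp add: algebra_simps)
    ultimately have "(z + 1) * (s * (z + 1) + 1) = 0"
      by simp
    then have "z = 1 \<or> s * (z + 1) = 1"
      by (simp add: add_eq_0_iff_eq)
    moreover have "z = 1 + 1 / s" if "s * (z + 1) = 1"
    proof -
      have "z + 1 = 1 / s"
        using that by (auto simp: eq_divide_eq mult.commute)
      then show ?thesis
        by (metis add.commute add_self_left)
    qed
    ultimately show ?thesis
      by blast
  qed
  then have "card unit_circle \<le> card {1, 1 + 1 / s}"
    by (intro card_mono) auto
  also have "\<dots> \<le> 2"
    by (simp add: card_insert_if)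
  finally show False
    using q_ge_2 by (simp add: card_unit_circle)
qed

text \<open>For fixed \<open>y\<close> the equation is linear in \<open>x\<close> over the small
  field, namely \<open>tr (x * \<kappa>) = 0\<close>. It is solved by \<open>cj \<kappa>\<close>,
  and \<open>tr (s * (y * y)) \<noteq> 1\<close> keeps \<open>T (cj \<kappa>) y\<close>
  nonzero.\<close>

lemma rho_surj:
  assumes \<phi>: "cj \<phi> = \<phi> + 1"
  obtains x y where "T x y \<noteq> 0" "rho s x y = \<phi>"
proof -
  obtain z where z: "z \<in> unit_circle" "tr (s * z) \<noteq> 1"
    by (rule zero_free_point)
  obtain y where y: "y \<in> unit_circle" "y * y = z"
    using unit_circle_sqrt[OF z(1)] by blast
  have y0: "y \<noteq> 0" "y * cj y = 1"
    using unit_circleD[OF y(1)] by auto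
  define \<kappa> where "\<kappa> = cj \<phi> * cj y + s * y"
  have "\<exists>x. T x y \<noteq> 0 \<and> tr (x * \<kappa>) = 0"
  proof (cases "\<kappa> = 0")
    case True
    then show ?thesis
      using T_nondegenerate[OF y0(1)] by (metis add_self cj_0 mult_zero_right tr_def)
  next
    case False
    have "T (cj \<kappa>) y = cj (y * \<kappa>) + y * \<kappa>"
      by (simp add: T_def mult_ac)
    also have "\<dots> = (cj \<phi> + \<phi>) * (y * cj y) + tr (s * z)"
      unfolding y(2)[symmetric] by (simp add: \<kappa>_def tr_def algebra_simps)
    also have "\<dots> \<noteq> 0"
      using z(2) by (simp add: y0 \<phi> add_eq_0_iff_eq)
    finally show ?thesis
      by (intro exI[of _ "cj \<kappa>"]) (simp add: tr_def mult.commute)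
  qed
  then obtain x where x: "T x y \<noteq> 0" "tr (x * \<kappa>) = 0"
    by blast
  have "x * cj y + tr (s * x * y) + \<phi> * T x y = tr (x * \<kappa>)"
    by (simp add: \<kappa>_def tr_def T_def \<phi>) (simp add: algebra_simps)
  then have "rho s x y = \<phi>"
    using x by (simp add: rho_def add_eq_0_iff_eq divide_eq_eq)
  with x that show ?thesis
    by blast
qed

text \<open>In the numerator \<open>x * cj y\<close> has trace \<open>T x y\<close>, and the other
  summand is fixed by \<open>cj\<close>.\<close>

lemma cj_rho: "T x y \<noteq> 0 \<Longrightarrow> cj (rho s x y) = rho s x y + 1"
proof -
  assume nz: "T x y \<noteq> 0"
  have "cj (rho s x y) + rho s x y = (cj (x * cj y) + x * cj y) / T x y"
    by (simp add: rho_def flip: add_divide_distrib)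
  also have "cj (x * cj y) + x * cj y = T x y"
    by (simp add: T_def add_ac)
  finally have "cj (rho s x y) + rho s x y = 1"
    using nz by simp
  then show ?thesis
    by (metis add.commute add_self_left)
qed

lemma avoids_diag_iff:
  "avoids w s s \<longleftrightarrow> (\<nexists>\<phi>. cj \<phi> = \<phi> + 1 \<and> \<phi> ^ Q + \<phi> = 1 + w)"
proof -
  have eq: "1 + w + \<phi> ^ Q + \<phi> = 0 \<longleftrightarrow> \<phi> ^ Q + \<phi> = 1 + w" for \<phi>
    by (metis add.assoc add_eq_0_iff_eq)
  show ?thesis
    unfolding avoids_def eq using cj_rho rho_surj by metis
qed

subsection \<open>Linear substitutions and sums over the unit circle\<close>

text \<open>The substitution is linear over the small field, with determinant
  \<open>1 + r * cj r\<close>.\<close>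

lemma T_subst: "T (x + r * cj x) (y + r * cj y) = (1 + r * cj r) * T x y"
  by (simp add: T_def algebra_simps)

lemma rho_subst:
  assumes D: "1 + r * cj r \<noteq> 0" and nz: "T x y \<noteq> 0"
  shows "rho s (x + r * cj x) (y + r * cj y)
    = rho ((s + cj s * (cj r * cj r) + cj r) / (1 + r * cj r)) x y
      + (r * cj r + tr (s * r)) / (1 + r * cj r)"
proof -
  define D where "D = 1 + r * cj r"
  define s' where "s' = (s + cj s * (cj r * cj r) + cj r) / D"
  have D0: "D \<noteq> 0" and cD: "cj D = D"
    using D by (simp_all add: D_def mult.commute)
  have "D * tr (s' * x * y) = tr (D * s' * x * y)"
    using tr_mult_fixed[OF cD, of "s' * x * y"] by (simp add: mult.assoc)
  also have "D * s' = s + cj s * (cj r * cj r) + cj r"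
    using D0 by (simp add: s'_def)
  finally have 1: "D * tr (s' * x * y) = tr ((s + cj s * (cj r * cj r) + cj r) * x * y)" .
  have "(x + r * cj x) * cj (y + r * cj y) + tr (s * (x + r * cj x) * (y + r * cj y))
     = D * (x * cj y) + D * tr (s' * x * y) + (r * cj r + tr (s * r)) * T x y"
    unfolding 1 by (simp add: tr_def T_def D_def) (simp add: algebra_simps)
  then have "rho s (x + r * cj x) (y + r * cj y)
     = (D * (x * cj y) + D * tr (s' * x * y) + (r * cj r + tr (s * r)) * T x y) / (D * T x y)"
    by (simp only: rho_def T_subst D_def)
  also have "\<dots> = rho s' x y + (r * cj r + tr (s * r)) / D"
    using D0 nz by (simp add: rho_def add_divide_distrib flip: distrib_left)
  finally show ?thesis
    by (simp only: s'_def D_def)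
qed

text \<open>With \<open>rho_subst\<close>, this carries the norm relation between \<open>s\<close>,
  \<open>t\<close> and \<open>w\<close> through the substitution.\<close>

lemma norm_subst:
  assumes "1 + r * cj r \<noteq> 0"
  defines "Y \<equiv> \<lambda>s. (r * cj r + tr (s * r)) / (1 + r * cj r)"
    and "S \<equiv> \<lambda>s. (s + cj s * (cj r * cj r) + cj r) / (1 + r * cj r)"
  shows "S s * cj (S s) = s * cj s + Y s * Y s + Y s"
proof -
  define D where "D = 1 + r * cj r"
  have D0: "D \<noteq> 0" and cD: "cj D = D"
    using assms(1) by (simp_all add: D_def mult.commute)
  define y where "y = r * cj r + tr (s * r)"
  define x where "x = s + cj s * (cj r * cj r) + cj r"
  have eq: "x * cj x = s * cj s * (D * D) + y * y + y * D"
    unfolding D_def y_def x_def tr_def by (simp add: algebra_simps)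
  have "S s * cj (S s) = x * cj x / (D * D)"
    by (simp add: S_def cD flip: x_def D_def)
  also have "\<dots> = s * cj s + y / D * (y / D) + y / D"
    unfolding eq using D0 by (simp add: add_divide_distrib)
  finally show ?thesis
    by (simp only: Y_def y_def D_def)
qed

text \<open>
  On the unit circle \<open>1 / (1 + K z)\<close> is a multiple of the geometric sum of the powers of \<open>K z\<close> up
  to \<open>q\<close>, and only two terms of the product survive summation.
\<close>

lemma sum_unit_circle_fraction:
  assumes K: "1 + K * cj K \<noteq> 0"
  shows "(\<Sum>z\<in>unit_circle. z ^ Q * (z + cj K) / (1 + K * z)) = 0 \<longleftrightarrow> K = 0"
proof -
  define n where "n = 1 + K * cj K"
  have n0: "n \<noteq> 0"
    using K by (simp add: n_def)
  have inv: "n / (1 + K * z) = (\<Sum>i<q + 1. (K * z) ^ i)" if z: "z \<in> unit_circle" for z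
  proof -
    have "(K * z) ^ (q + 1) = (K * cj K) * (z * cj z)"
      unfolding power_add power_one_right cj_eq[symmetric] by (simp add: mult_ac)
    then have "(K * z) ^ (q + 1) = K * cj K"
      using z unfolding unit_circle_def by (simp only: mem_Collect_eq mult_1_right)
    then have "n = (1 + K * z) * (\<Sum>i<q + 1. (K * z) ^ i)"
      using one_diff_power_eq[of "K * z" "q + 1"] by (simp only: n_def minus_eq)
    then show ?thesis
      using n0 by (metis mult_zero_left nonzero_mult_div_cancel_left)
  qed
  \<comment> \<open>Chosen so that \<open>Q + 1 + i0\<close> is the next multiple of
    \<open>q + 1\<close>; it marks the surviving terms \<open>i0\<close> and
    \<open>i0 + 1\<close>.\<close>
  define i0 where "i0 = q - Q mod (q + 1)"
  have Qm: "\<not> (q + 1) dvd Q"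
  proof
    assume "(q + 1) dvd Q"
    moreover have "coprime (q + 1) Q"
      using k by (simp add: q Q coprime_commute)
    ultimately have "q + 1 = 1"
      by (metis coprime_absorb_left nat_dvd_1_iff_1)
    then show False
      using q_ge_2 by simp
  qed
  have Qi: "Q + 1 + i0 = (q + 1) * (Q div (q + 1) + 1)"
  proof -
    have "Q mod (q + 1) \<le> q"
      using mod_less_divisor[of "q + 1" Q] by linarith
    then have "Q mod (q + 1) + 1 + i0 = q + 1"
      unfolding i0_def by simp
    moreover have "Q = (q + 1) * (Q div (q + 1)) + Q mod (q + 1)"
      by (simp only: mult_div_mod_eq)
    ultimately show ?thesis
      by (simp add: algebra_simps)
  qed
  have i0: "i0 + 1 < q + 1"
    unfolding i0_def using Qm q_ge_2 by (auto simp: dvd_eq_mod_eq_0)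
  have dvd_iff: "(q + 1) dvd (Q + 1 + i) \<longleftrightarrow> i = i0" if "i < q + 1" for i
  proof
    assume *: "(q + 1) dvd (Q + 1 + i)"
    have "(q + 1) dvd (Q + 1 + i0)"
      unfolding Qi by (rule dvd_triv_left)
    with * have "[Q + 1 + i = Q + 1 + i0] (mod (q + 1))"
      by (simp add: cong_def dvd_eq_mod_eq_0)
    then have "[i = i0] (mod (q + 1))"
      by (simp only: cong_add_lcancel_nat)
    then show "i = i0"
      using that i0 by (simp add: cong_def)
  qed (simp only: Qi dvd_triv_left)
  have dvd_iff': "(q + 1) dvd (Q + i) \<longleftrightarrow> i = i0 + 1" if "i < q + 1" for i
    using Qm dvd_iff[of "i - 1"] that by (cases i) auto
  have sum: "(\<Sum>z\<in>unit_circle. z ^ j) = (if (q + 1) dvd j then 1 else 0)" for j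
    using sum_unit_circle sum_unit_circle_dvd by simp
  have "n * (\<Sum>z\<in>unit_circle. z ^ Q * (z + cj K) / (1 + K * z))
      = (\<Sum>z\<in>unit_circle. z ^ Q * (z + cj K) * (n / (1 + K * z)))"
    by (simp add: sum_distrib_left mult_ac)
  also have "\<dots> = (\<Sum>z\<in>unit_circle. \<Sum>i<q + 1. K ^ i * z ^ (Q + 1 + i) + cj K * K ^ i * z ^ (Q + i))"
    by (intro sum.cong refl, subst inv, assumption)
      (simp only: sum_distrib_left, intro sum.cong refl, simp add: power_add power_mult_distrib algebra_simps)
  also have "\<dots> = (\<Sum>i<q + 1. K ^ i * (\<Sum>z\<in>unit_circle. z ^ (Q + 1 + i))
      + cj K * K ^ i * (\<Sum>z\<in>unit_circle. z ^ (Q + i)))"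
    by (subst sum.swap) (simp only: sum.distrib sum_distrib_left)
  also have "\<dots> = (\<Sum>i<q + 1. (if i = i0 then K ^ i else 0) + (if i = i0 + 1 then cj K * K ^ i else 0))"
    by (intro sum.cong refl) (simp only: sum dvd_iff dvd_iff' lessThan_iff, simp)
  also have "\<dots> = K ^ i0 + cj K * K ^ (i0 + 1)"
    using i0 by (subst sum.distrib) (simp add: sum.delta)
  also have "\<dots> = n * K ^ i0"
    by (simp add: n_def algebra_simps)
  finally have eq: "(\<Sum>z\<in>unit_circle. z ^ Q * (z + cj K) / (1 + K * z)) = K ^ i0"
    using n0 by simp
  \<comment> \<open>Coprimality of \<open>Q + 1\<close> and \<open>q + 1\<close> enters here:
    \<open>K ^ i0\<close> has to vanish for \<open>K = 0\<close>.\<close>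
  have "i0 > 0"
  proof (rule ccontr)
    assume "\<not> i0 > 0"
    then have "(q + 1) dvd (Q + 1)"
      using Qi by (metis add_0_right dvd_triv_left not_gr_zero)
    then have "q + 1 = 1"
      using coprime_Q_q by (metis coprime_absorb_right nat_dvd_1_iff_1)
    then show False
      using q_ge_2 by simp
  qed
  then show ?thesis
    unfolding eq by simp
qed

text \<open>
  Otherwise \<open>h\<close>, the action of the form \<open>(1 + w, cj s, 0, 0)\<close> on the unit circle, would be a
  permutation, so its values would have sum zero, contrary to the previous lemma.
\<close>

lemma avoids_zero:
  assumes av: "avoids w 0 s" and cw: "cj w = w" and N: "s * cj s = w * w + w"
  shows "s = 0"
proof (rule ccontr)
  assume s0: "s \<noteq> 0"
  have w1: "w \<noteq> 1" "w \<noteq> 0"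
    using N s0 by auto
  define b where "b = 1 + w"
  have b0: "b \<noteq> 0" and cb: "cj b = b"
    using w1 cw by (auto simp: b_def add_eq_0_iff_eq)
  define K where "K = s / b"
  have cK: "cj K = cj s / b"
    by (simp add: K_def cb)
  have "s * cj s = w * b"
    by (simp add: N b_def algebra_simps)
  then have "K * cj K = (w * b) / (b * b)"
    by (simp add: K_def cb)
  then have "K * cj K = w / b"
    using b0 by simp
  moreover have "1 + w / b = (b + w) / b"
    using b0 by (simp add: add_divide_distrib)
  ultimately have KK: "1 + K * cj K = 1 / b"
    by (simp add: b_def)
  have d0: "1 + K * z \<noteq> 0" if "z \<in> unit_circle" for z
  proof
    assume "1 + K * z = 0"
    then have "K * z = 1"
      by (simp add: add_eq_0_iff_eq)
    then have "(K * cj K) * (z * cj z) = 1"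
      by (metis cj_1 cj_mult mult.assoc mult.left_commute mult_1)
    then have "K * cj K = 1"
      using that unfolding unit_circle_def by (simp only: mem_Collect_eq mult_1_right)
    then show False
      using KK b0 by simp
  qed
  \<comment> \<open>For \<open>x\<close> on the circle, \<open>h (x * x)\<close> is the quotient
    \<open>F x / cj (F x)\<close>.\<close>
  define h where "h = (\<lambda>z. z ^ Q * (z + cj K) / (1 + K * z))"
  define F where "F = form b (cj s) 0 0"
  have F_h: "F x = h (x * x) * cj (F x)" "cj (F x) \<noteq> 0" if x: "x \<in> unit_circle" for x
  proof -
    have x0: "x \<noteq> 0" "cj x = 1 / x"
      using unit_circleD[OF x] .
    have xx: "x * x \<in> unit_circle"
      using x0 by (simp add: unit_circle_def)
    have Fx: "F x = b * x ^ Q * (x * x + cj K) / x"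
      using x0 b0 by (simp add: F_def form_def cK field_simps)
    have "cj (F x) = b * cj x ^ Q * (cj x + K * x)"
      using b0 by (simp add: F_def form_def cb K_def distrib_left)
    then have cFx: "cj (F x) = b * (1 + K * (x * x)) / (x ^ Q * x)"
      unfolding x0(2) using x0(1) by (simp add: power_divide field_simps)
    show "F x = h (x * x) * cj (F x)"
    proof -
      have "X * X * u / P * (b * P / (X * x)) = b * X * u / x" if "P \<noteq> 0" "X \<noteq> 0" for P X u
        using that x0(1) by (simp add: field_simps)
      from this[OF d0[OF xx], of "x ^ Q" "x * x + cj K"] show ?thesis
        unfolding cFx unfolding Fx h_def power_mult_distrib using x0(1) by simp
    qed
    show "cj (F x) \<noteq> 0"
      using x0 b0 d0[OF xx] by (simp add: cFx)
  qed
  have "h ` unit_circle \<subseteq> unit_circle"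
  proof
    fix y assume "y \<in> h ` unit_circle"
    then obtain x where x: "x \<in> unit_circle" "y = h (x * x)"
      by (auto elim: unit_circle_sqrt)
    then have "y = F x / cj (F x)"
      using F_h[OF x(1)] by (metis nonzero_mult_div_cancel_right)
    then show "y \<in> unit_circle"
      using F_h[OF x(1)] by (simp add: unit_circle_def)
  qed
  moreover have "inj_on h unit_circle"
  proof (rule inj_onI)
    fix z z' assume z: "z \<in> unit_circle" "z' \<in> unit_circle" and hz: "h z = h z'"
    obtain x y where x: "x \<in> unit_circle" "x * x = z" and y: "y \<in> unit_circle" "y * y = z'"
      using z unit_circle_sqrt by metis
    have "F x * cj (F y) = h z * cj (F x) * cj (F y)"
      using F_h(1)[OF x(1)] x(2) by simp
    also have "\<dots> = cj (F x) * F y"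
      using F_h(1)[OF y(1)] y(2) hz by (simp add: mult_ac)
    finally have TF: "T (F x) (F y) = 0"
      by (simp add: T_def)
    have "T x y = 0"
    proof (rule ccontr)
      assume nz: "T x y \<noteq> 0"
      \<comment> \<open>By \<open>N\<close>, the discriminant \<open>b * b + s * cj s\<close> of
        this form is \<open>b\<close> itself.\<close>
      have "T (F x) (F y) = b * (T x y ^ Q * T x y) * (1 + w + rho 0 x y ^ Q + rho s x y)"
        unfolding F_def
        by (rule T_form_eq_rho) (use nz cb N in \<open>simp_all add: b_def algebra_simps\<close>)
      then show False
        using TF nz b0 av unfolding avoids_def by simp
    qed
    then have "x * cj y = cj x * y"
      by (simp add: T_def add_eq_0_iff_eq)
    then have "x * x = y * y"
      using unit_circleD[OF x(1)] unit_circleD[OF y(1)] by (simp add: field_simps)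
    then show "z = z'"
      using x y by simp
  qed
  ultimately have "bij_betw h unit_circle unit_circle"
    by (simp add: bij_betw_def endo_inj_surj)
  then have "(\<Sum>z\<in>unit_circle. h z) = (\<Sum>z\<in>unit_circle. z ^ 1)"
    by (simp add: sum.reindex_bij_betw[where g = "\<lambda>x. x"])
  also have "\<dots> = 0"
    using q_ge_2 by (intro sum_unit_circle) simp
  finally have "K = 0"
    using sum_unit_circle_fraction[of K] KK b0 by (simp add: h_def)
  then show False
    using s0 b0 by (simp add: K_def)
qed

section \<open>Quadratic equations and the proof that \<open>t = s\<close>\<close>

text \<open>Over the prime field the trace of \<open>c\<close> from the large field counts every
  conjugate twice, hence is 0.\<close>

lemma artin_schreier_root:
  assumes "cj c = c"
  obtains u where "u * u + u = c"
proof -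
  have "\<exists>u. u ^ 2 + u = c"
  proof (rule additive_hilbert90[where n = "k + k" and d = 1])
    show "CARD('a) = 2 ^ (k + k)"
      by (simp add: card q power_add power2_eq_square)
    have "c ^ 2 ^ (k + i) = c ^ 2 ^ i" for i
      using assms unfolding cj_eq by (simp add: power_add power_mult flip: q)
    then show "(\<Sum>i<k + k. c ^ 2 ^ i) = 0"
      by (simp add: sum_lessThan_add)
  qed (use k in auto)
  then show ?thesis
    using that by (auto simp: power2_eq_square)
qed

text \<open>For \<open>t \<noteq> 0\<close>, putting \<open>r = u / t\<close> gives the
  Artin-Schreier equation for \<open>t * cj t\<close>.\<close>

lemma quadratic_root: obtains r where "t * (r * r) + r + cj t = 0"
proof (cases "t = 0")
  case True
  then show ?thesis
    using that[of 0] by simp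
next
  case False
  obtain u where u: "u * u + u = t * cj t"
    by (rule artin_schreier_root[of "t * cj t"]) (simp_all add: mult.commute)
  have "t * (u / t * (u / t)) + u / t + cj t = (u * u + u + t * cj t) / t"
    using False by (simp add: field_simps)
  then have "t * (u / t * (u / t)) + u / t + cj t = 0"
    by (simp add: u)
  then show ?thesis
    using that by blast
qed

text \<open>
  If \<open>tr (t z) = 1\<close> has no solution on the unit circle, then a root \<open>r\<close> of \<open>t r\<^sup>2 + r + cj t\<close> has
  norm different from 1, and the linear substitution \<open>x \<mapsto> x + r cj x\<close> makes \<open>t\<close> vanish.
\<close>

lemma avoids_imp_eq:
  assumes av: "avoids w t s" and cw: "cj w = w"
    and N: "s * cj s + (t * cj t) ^ Q = w * w + w"
  shows "t = s"
proof (cases "\<exists>z\<in>unit_circle. tr (t * z) = 1")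
  case True
  then show ?thesis
    using avoids_split[OF av cw] by blast
next
  case False
  obtain r where r: "t * (r * r) + r + cj t = 0"
    by (rule quadratic_root)
  have D0: "1 + r * cj r \<noteq> 0"
  proof
    assume "1 + r * cj r = 0"
    then have rr: "r * cj r = 1"
      by (simp add: add_eq_0_iff_eq)
    \<comment> \<open>Norm 1 would turn the quadratic, multiplied by \<open>cj r\<close>, into the
      excluded trace equation at \<open>r\<close>.\<close>
    have "t * r + 1 + cj t * cj r = (t * (r * r) + r + cj t) * cj r"
      using rr by (simp add: algebra_simps)
    then have "tr (t * r) = 1"
      using r by (simp add: tr_def) (metis add.assoc add.commute add_eq_0_iff_eq)
    then show False
      using False rr by (auto simp: unit_circle_def)
  qed
  define Y where "Y = (\<lambda>s. (r * cj r + tr (s * r)) / (1 + r * cj r))"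
  define S where "S = (\<lambda>s. (s + cj s * (cj r * cj r) + cj r) / (1 + r * cj r))"
  have cY: "cj (Y s) = Y s" for s
    by (simp add: Y_def mult.commute)
  have norm: "S s * cj (S s) = s * cj s + Y s * Y s + Y s" for s
    using norm_subst[OF D0] by (simp add: S_def Y_def)
  have "S t = cj (t * (r * r) + r + cj t) / (1 + r * cj r)"
    by (simp add: S_def add_ac)
  then have St: "S t = 0"
    by (simp only: r cj_0 div_0)
  \<comment> \<open>The substitution moves \<open>t\<close> to \<open>S t = 0\<close>, and its
    additive shifts are absorbed into \<open>w\<close>.\<close>
  have "avoids (w + Y t ^ Q + Y s) 0 (S s)"
    unfolding avoids_def
  proof safe
    fix x y assume nz: "T x y \<noteq> 0" and 0: "1 + (w + Y t ^ Q + Y s) + rho 0 x y ^ Q + rho (S s) x y = 0"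
    have "T (x + r * cj x) (y + r * cj y) \<noteq> 0"
      using nz D0 by (simp add: T_subst)
    then have "1 + w + rho t (x + r * cj x) (y + r * cj y) ^ Q + rho s (x + r * cj x) (y + r * cj y) \<noteq> 0"
      using av by (simp add: avoids_def)
    moreover have "rho s (x + r * cj x) (y + r * cj y) = rho (S s) x y + Y s" for s
      using rho_subst[OF D0 nz] by (simp add: S_def Y_def)
    ultimately show False
      using 0 by (simp add: St Q_add add_ac)
  qed
  moreover have "cj (w + Y t ^ Q + Y s) = w + Y t ^ Q + Y s"
    by (simp add: cw cY)
  moreover have "S s * cj (S s) = (w + Y t ^ Q + Y s) * (w + Y t ^ Q + Y s) + (w + Y t ^ Q + Y s)"
  proof -
    have "t * cj t = Y t * Y t + Y t"
      using norm[of t] by (simp add: St) (metis add.assoc add_eq_0_iff_eq)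
    then have "s * cj s = w * w + w + (Y t ^ Q * Y t ^ Q + Y t ^ Q)"
      unfolding N[symmetric] by (simp add: Q_add power_mult_distrib add.assoc)
    then show ?thesis
      unfolding norm by (simp add: algebra_simps)
  qed
  ultimately have "S s = 0"
    by (rule avoids_zero)
  then have "S t + S s = 0"
    using St by simp
  \<comment> \<open>The constant \<open>cj r\<close> cancels in \<open>S t + S s\<close>, leaving an
    expression in \<open>d\<close>. Taking norms then forces \<open>d = 0\<close>, since
    \<open>r\<close> does not have norm 1.\<close>
  define d where "d = t + s"
  have "S t + S s = (d + cj d * (cj r * cj r)) / (1 + r * cj r)"
    by (simp add: S_def d_def add_divide_distrib[symmetric]) (simp add: algebra_simps)
  then have d: "d = cj d * (cj r * cj r)"
    using \<open>S t + S s = 0\<close> D0 by (simp add: add_eq_0_iff_eq)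
  have "d * cj d = (d * cj d) * ((r * cj r) * (r * cj r))"
    by (subst (1 2) d) (simp add: mult_ac)
  moreover have "(1 + r * cj r) * (1 + r * cj r) \<noteq> 0"
    using D0 by simp
  ultimately have "d = 0"
    by (auto simp: algebra_simps add_eq_0_iff_eq)
  then show ?thesis
    by (simp add: d_def add_eq_0_iff_eq)
qed

subsection \<open>Projective injectivity\<close>

definition projectively_injective :: "('a \<Rightarrow> 'a) \<Rightarrow> bool" where
  "projectively_injective F \<longleftrightarrow> (\<forall>x y. T x y \<noteq> 0 \<longrightarrow> T (F x) (F y) \<noteq> 0)"

text \<open>For \<open>s \<noteq> 0\<close>, a square root \<open>z\<close> of
  \<open>cj s / s\<close> makes \<open>s * z\<close> fixed by \<open>cj\<close>.\<close>

lemma unit_circle_trace_zero: obtains z where "z \<in> unit_circle" "tr (s * z) = 0"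
proof (cases "s = 0")
  case True
  then show ?thesis
    using that[of 1] by (simp add: unit_circle_def tr_def)
next
  case False
  then have "cj s / s \<in> unit_circle"
    by (simp add: unit_circle_def)
  then obtain z where z: "z \<in> unit_circle" "z * z = cj s / s"
    using unit_circle_sqrt by blast
  have "s * z = s * (z * z) * cj z"
    using z(1) by (simp add: unit_circle_def mult.assoc)
  also have "\<dots> = cj s * cj z"
    using False by (simp add: z(2))
  finally have "s * z = cj s * cj z" .
  then show ?thesis
    using that z(1) by (simp add: tr_def)
qed

text \<open>If the discriminant is 0, injectivity makes
  \<open>G z + (p * tr (t * z)) ^ Q + p * tr (s * z)\<close> nonzero for all fixed \<open>p\<close>.
  At a \<open>z\<close> with \<open>tr (s * z) = 0\<close> one can solve for \<open>p\<close> unless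
  \<open>tr (t * z) = 0\<close>, and then \<open>pluecker\<close> gives
  \<open>G z = 0\<close>.\<close>

lemma discriminant_nonzero:
  assumes inj: "projectively_injective (form A B C E)"
  shows "A * cj A + B * cj B + C * cj C + E * cj E \<noteq> 0"
proof
  assume e0: "A * cj A + B * cj B + C * cj C + E * cj E = 0"
  define \<beta> s where "\<beta> = B * cj B + C * cj C" and "s = A * cj B + C * cj E"
  obtain t where t: "t ^ Q = A * cj C + B * cj E"
    using Q_root by blast
  have N: "s * cj s + (t * cj t) ^ Q = \<beta> * \<beta>"
    using pluecker[of A B C E] by (simp add: e0 power_mult_distrib t \<beta>_def s_def flip: cj_power)
  have c\<beta>: "cj \<beta> = \<beta>"
    by (simp add: \<beta>_def mult.commute)
  obtain \<theta> where \<theta>: "cj \<theta> = \<theta> + 1"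
    by (rule trace_one)
  define G where "G = (\<lambda>z. \<beta> + tr (t * \<theta> * z) ^ Q + tr (s * \<theta> * z))"
  have cG: "cj (G z) = G z" for z
    by (simp add: G_def c\<beta>)
  have ne: "G z + (p * tr (t * z)) ^ Q + p * tr (s * z) \<noteq> 0"
    if z: "z \<in> unit_circle" and p: "cj p = p" for z p
  proof -
    obtain y where y: "y \<in> unit_circle" "y * y = z"
      using unit_circle_sqrt[OF z] by blast
    have T1: "T ((\<theta> + p) * y) y = 1"
      by (rule rho_linear(1)[OF y(1)]) (simp add: \<theta> p add_ac)
    have xy: "(\<theta> + p) * y * y = (\<theta> + p) * z"
      by (simp add: mult.assoc y(2))
    have "tr (t ^ Q * ((\<theta> + p) * z) ^ Q) = tr (t * ((\<theta> + p) * z)) ^ Q"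
      by (simp add: tr_def power_mult_distrib Q_add)
    also have "tr (t * ((\<theta> + p) * z)) = tr (t * \<theta> * z) + p * tr (t * z)"
      by (simp add: tr_def p algebra_simps)
    finally have 1: "tr (t ^ Q * ((\<theta> + p) * z) ^ Q) = tr (t * \<theta> * z) ^ Q + (p * tr (t * z)) ^ Q"
      by (simp only: Q_add)
    have 2: "tr (s * ((\<theta> + p) * z)) = tr (s * \<theta> * z) + p * tr (s * z)"
      by (simp add: tr_def p algebra_simps)
    have "T (form A B C E ((\<theta> + p) * y)) (form A B C E y) \<noteq> 0"
      using inj T1 by (simp add: projectively_injective_def)
    then show ?thesis
      unfolding T_form e0 T1 xy \<beta>_def[symmetric] s_def[symmetric] t[symmetric] 1 2
      by (simp add: G_def add_ac)
  qed
  obtain z where z: "z \<in> unit_circle" "tr (s * z) = 0"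
    by (rule unit_circle_trace_zero)
  have tz: "tr (t * z) = 0"
  proof (rule ccontr)
    assume nz: "tr (t * z) \<noteq> 0"
    obtain u where u: "u ^ Q = G z"
      using Q_root by blast
    then have "cj u = u"
      using cG[of z] by (metis Q_inj cj_power)
    then have "cj (u / tr (t * z)) = u / tr (t * z)"
      by simp
    from ne[OF z(1) this] show False
      using nz by (simp add: z u)
  qed
  have fixed: "cj (r * z) = r * z" "tr (r * \<theta> * z) = r * z" if "tr (r * z) = 0" for r
  proof -
    show c: "cj (r * z) = r * z"
      using that unfolding tr_def by (simp only: add_eq_0_iff_eq)
    have "tr (r * \<theta> * z) = r * z * tr \<theta>"
      using tr_mult_fixed[OF c, of \<theta>] by (simp add: mult_ac)
    then show "tr (r * \<theta> * z) = r * z"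
      by (simp add: tr_def \<theta>)
  qed
  have norm: "(r * z) * (r * z) = r * cj r" if "tr (r * z) = 0" for r
  proof -
    have "(r * z) * (r * z) = (r * z) * cj (r * z)"
      by (simp only: fixed(1)[OF that])
    also have "\<dots> = r * cj r * (z * cj z)"
      by (simp add: mult_ac)
    also have "z * cj z = 1"
      using z(1) by (simp add: unit_circle_def)
    finally show ?thesis
      by (simp only: mult_1_right)
  qed
  have G: "G z = \<beta> + (t * z) ^ Q + s * z"
    unfolding G_def fixed(2)[OF tz] fixed(2)[OF z(2)] ..
  have "G z * G z = \<beta> * \<beta> + ((t * z) * (t * z)) ^ Q + (s * z) * (s * z)"
    unfolding G power_mult_distrib by (simp add: algebra_simps)
  also have "\<dots> = 0"
    unfolding norm[OF tz] norm[OF z(2)] N[symmetric] by (simp add: add_ac)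
  finally have "G z = 0"
    by simp
  then show False
    using ne[OF z(1), of 0] by simp
qed

section \<open>The trace criterion and the equivalence for forms\<close>

lemma square_eq_self: "x * x + x = 0 \<longleftrightarrow> x = 0 \<or> x = (1 :: 'a)"
proof -
  have "x * x + x = x * (x + 1)"
    by (simp add: algebra_simps)
  then show ?thesis
    by (simp add: add_eq_0_iff_eq)
qed

text \<open>
  With \<open>\<psi>\<^sup>2 + \<psi> = S\<close> the hypothesis says \<open>w = \<psi>\<^sup>Q + \<psi> + \<epsilon>\<close> with \<open>\<epsilon> \<in> {0, 1}\<close>; the candidates for \<open>\<phi>\<close> are \<open>\<psi>\<close>
  and \<open>\<psi> + \<chi>\<close> where \<open>\<chi>\<^sup>r + \<chi> = 1\<close> for \<open>r = 2\<^sup>m\<close>.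
\<close>

lemma exists_phi_iff:
  fixes m :: nat and w S :: 'a
  assumes m: "m > 0" "m dvd k" "m dvd l" and odd: "odd (k div m + l div m)"
    and cS: "cj S = S" and w: "w * w + w = S ^ Q + S"
  shows "(\<exists>\<phi>. cj \<phi> = \<phi> + 1 \<and> \<phi> ^ Q + \<phi> = 1 + w) \<longleftrightarrow> finite_field_trace (2 ^ m) (k div m) w \<noteq> 0"
proof -
  define r K L where "r = (2 :: nat) ^ m" and "K = k div m" and "L = l div m"
  have q_r: "q = r ^ K" and Q_r: "Q = r ^ L"
    using m by (simp_all add: q Q r_def K_def L_def flip: power_mult)
  define tau :: "'a \<Rightarrow> 'a" where "tau = finite_field_trace r K"
  have r_add: "(x + y :: 'a) ^ (r ^ i) = x ^ (r ^ i) + y ^ (r ^ i)" for x y i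
    unfolding r_def by (simp only: frobenius_add flip: power_mult)
  have tau_add: "tau (x + y) = tau x + tau y" for x y
    by (simp add: tau_def finite_field_trace_def r_add sum.distrib)
  have tau_Q: "tau (x ^ Q) = tau x ^ Q" for x
  proof -
    have sum_Q: "(\<Sum>i<n. f i) ^ Q = (\<Sum>i<n. f i ^ Q)" for n and f :: "nat \<Rightarrow> 'a"
      by (induction n) (simp_all add: Q_add)
    show ?thesis
      unfolding tau_def finite_field_trace_def sum_Q by (simp add: mult.commute flip: power_mult)
  qed
  \<comment> \<open>Raising to the power \<open>r\<close> shifts the sum of conjugates by one place,
    and the last one is \<open>cj x\<close>.\<close>
  have tau_r: "tau x ^ r = tau x + (cj x + x)" for x
  proof -
    have sum_r: "(\<Sum>i<n. f i) ^ r = (\<Sum>i<n. f i ^ r)" for n and f :: "nat \<Rightarrow> 'a"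
      using r_add[where i = 1] by (induction n) (simp_all add: zero_power r_def)
    have "tau x ^ r = (\<Sum>i<K. x ^ (r ^ Suc i))"
      unfolding tau_def finite_field_trace_def sum_r by (simp add: mult.commute flip: power_mult)
    then have "tau x ^ r - tau x = (\<Sum>i<K. x ^ (r ^ Suc i) - x ^ (r ^ i))"
      by (simp only: tau_def finite_field_trace_def sum_subtractf)
    also have "\<dots> = cj x - x"
      by (subst sum_lessThan_telescope) (simp add: cj_eq q_r)
    finally have "tau x ^ r + tau x = cj x + x"
      by simp
    then have "tau x + (tau x ^ r + tau x) = tau x + (cj x + x)"
      by simp
    then show ?thesis
      by (simp add: add.left_commute[of "tau x" "tau x ^ r"])
  qed
  have iter: "y ^ (r ^ j) = y + of_nat j * d" if "y ^ r = y + d" "d ^ r = d" for y d :: 'a and j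
  proof (induction j)
    case (Suc j)
    have "(of_nat j * d) ^ r = of_nat j * d"
      using that(2) r_add[where i = 1] by (induction j) (simp_all add: zero_power r_def distrib_right)
    then have "y ^ (r ^ Suc j) = y + d + of_nat j * d"
      using Suc that r_add[where i = 1] by (simp add: mult.commute[of r] power_mult)
    then show ?case
      by (simp add: algebra_simps)
  qed simp
  have tau_const: "tau c = of_nat K * c" if "c = 0 \<or> c = 1" for c
    using that by (auto simp: tau_def finite_field_trace_def zero_power r_def)
  have KL: "(of_nat K = (0 :: 'a) \<and> of_nat L = (1 :: 'a)) \<or> (of_nat K = (1 :: 'a) \<and> of_nat L = (0 :: 'a))"
  proof -
    have ev: "of_nat n = (0 :: 'a)" if "even n" for n
      using that by (auto elim: evenE)
    have od: "of_nat n = (1 :: 'a)" if "odd n" for n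
      using that by (auto elim: oddE)
    show ?thesis
      using odd ev[of K] od[of K] ev[of L] od[of L] by (auto simp flip: K_def L_def)
  qed
  have pow01: "d ^ r = d" if "d = 0 \<or> d = 1" for d :: 'a
    using that by (auto simp: zero_power r_def)
  show ?thesis
    unfolding K_def[symmetric] r_def[symmetric] tau_def[symmetric]
  proof
    assume "\<exists>\<phi>. cj \<phi> = \<phi> + 1 \<and> \<phi> ^ Q + \<phi> = 1 + w"
    then obtain \<phi> where \<phi>: "cj \<phi> = \<phi> + 1" "\<phi> ^ Q + \<phi> = 1 + w"
      by blast
    \<comment> \<open>Applying \<open>tau\<close> to the equation for \<open>\<phi>\<close> gives
      \<open>tau w = K + L\<close>, which is 1 in the field.\<close>
    have "tau \<phi> ^ r = tau \<phi> + 1"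
      by (simp add: tau_r \<phi>(1) add_ac)
    then have "tau \<phi> ^ Q = tau \<phi> + of_nat L"
      using iter[of "tau \<phi>" 1 L] by (simp add: Q_r)
    moreover have "tau (\<phi> ^ Q) + tau \<phi> = tau 1 + tau w"
      by (simp only: \<phi>(2) flip: tau_add)
    ultimately have "of_nat L = of_nat K + tau w"
      by (simp add: tau_Q tau_const add_ac)
    then show "tau w \<noteq> 0"
      using KL by auto
  next
    assume nz: "tau w \<noteq> 0"
    obtain \<psi> where \<psi>: "\<psi> * \<psi> + \<psi> = S"
      using artin_schreier_root[OF cS] by blast
    define \<epsilon> \<delta> where "\<epsilon> = w + \<psi> ^ Q + \<psi>" and "\<delta> = cj \<psi> + \<psi>"
    have "\<epsilon> * \<epsilon> + \<epsilon> = (w * w + w) + (\<psi> * \<psi> + \<psi>) ^ Q + (\<psi> * \<psi> + \<psi>)"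
      unfolding \<epsilon>_def Q_add power_mult_distrib by (simp add: algebra_simps)
    then have "\<epsilon> * \<epsilon> + \<epsilon> = 0"
      unfolding \<psi> w by (simp add: add_ac)
    then have \<epsilon>: "\<epsilon> = 0 \<or> \<epsilon> = 1"
      by (simp only: square_eq_self)
    have "\<delta> * \<delta> + \<delta> = cj (\<psi> * \<psi> + \<psi>) + (\<psi> * \<psi> + \<psi>)"
      unfolding \<delta>_def by (simp add: algebra_simps)
    then have \<delta>: "\<delta> = 0 \<or> \<delta> = 1"
      unfolding \<psi> cS by (simp add: square_eq_self)
    have "\<exists>\<chi>. \<chi> ^ r + \<chi> = (1 :: 'a)"
    proof (rule additive_hilbert90[where n = "K + K" and d = m])
      show "CARD('a) = r ^ (K + K)"
        by (simp add: card q_r power_add power2_eq_square)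
      show "K + K > 0"
        using m k by (auto simp: K_def dvd_div_eq_0_iff)
    qed (use m in \<open>auto simp: r_def\<close>)
    then obtain \<chi> where \<chi>': "\<chi> ^ r + \<chi> = (1 :: 'a)"
      by blast
    have "\<chi> ^ r = \<chi> + 1"
      unfolding \<chi>'[symmetric] by (simp add: add_ac)
    from iter[OF this] have \<chi>: "cj \<chi> = \<chi> + of_nat K" "\<chi> ^ Q = \<chi> + of_nat L"
      by (simp_all add: cj_eq q_r Q_r)
    have "tau \<psi> ^ r = tau \<psi> + \<delta>"
      by (simp add: tau_r \<delta>_def)
    then have "tau \<psi> ^ Q = tau \<psi> + of_nat L * \<delta>"
      using iter[of "tau \<psi>" \<delta> L] pow01[OF \<delta>] by (simp add: Q_r)
    moreover have "w = \<psi> ^ Q + \<psi> + \<epsilon>"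
      by (simp add: \<epsilon>_def add_ac)
    ultimately have "tau w = of_nat L * \<delta> + of_nat K * \<epsilon>"
      by (simp add: tau_add tau_Q tau_const[OF \<epsilon>] add_ac)
    then have cases: "(of_nat K = (0 :: 'a) \<and> of_nat L = (1 :: 'a) \<and> \<delta> = 1)
        \<or> (of_nat K = (1 :: 'a) \<and> of_nat L = (0 :: 'a) \<and> \<epsilon> = 1)"
      using KL nz \<epsilon> \<delta> by auto
    have c\<psi>: "cj \<psi> = \<psi> + \<delta>" and Q\<psi>: "\<psi> ^ Q + \<psi> = w + \<epsilon>"
      by (simp_all add: \<delta>_def \<epsilon>_def add_ac)
    show "\<exists>\<phi>. cj \<phi> = \<phi> + 1 \<and> \<phi> ^ Q + \<phi> = 1 + w"
    proof (cases "\<delta> = 1 \<and> \<epsilon> = 1")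
      case True
      then show ?thesis
        using c\<psi> Q\<psi> by (intro exI[of _ \<psi>]) (simp add: add.commute)
    next
      case False
      \<comment> \<open>Adding \<open>\<chi>\<close> changes \<open>\<delta>\<close> by
        \<open>K\<close> and \<open>\<epsilon>\<close> by \<open>L\<close>; by \<open>cases\<close>
        it corrects exactly the one that is not yet 1.\<close>
      have "cj (\<psi> + \<chi>) = \<psi> + \<chi> + (\<delta> + of_nat K)"
        by (simp add: c\<psi> \<chi> add_ac)
      moreover have "(\<psi> + \<chi>) ^ Q + (\<psi> + \<chi>) = (\<psi> ^ Q + \<psi>) + of_nat L"
        by (simp add: Q_add \<chi> add_ac)
      then have "(\<psi> + \<chi>) ^ Q + (\<psi> + \<chi>) = w + (\<epsilon> + of_nat L)"
        by (simp only: Q\<psi> add.assoc)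
      moreover have "\<delta> + of_nat K = 1" "\<epsilon> + of_nat L = 1"
        using False cases \<epsilon> \<delta> by auto
      ultimately show ?thesis
        by (metis add.commute)
    qed
  qed
qed

text \<open>Dividing by a nonzero \<open>e\<close> turns injectivity into
  \<open>avoids w t s\<close> and the middle condition into \<open>s = t\<close>. The norm relation
  that \<open>avoids_imp_eq\<close> needs comes from \<open>pluecker\<close>.\<close>

lemma projectively_injective_form_iff:
  fixes A B C E
  assumes m: "m > 0" "m dvd k" "m dvd l" "odd (k div m + l div m)"
  defines "e \<equiv> A * cj A + B * cj B + C * cj C + E * cj E"
  defines "w \<equiv> (B * cj B + C * cj C) / e"
  shows "projectively_injective (form A B C E) \<longleftrightarrow>
    e \<noteq> 0 \<and> (A * cj B + C * cj E) ^ Q = e ^ (Q - 1) * (A * cj C + B * cj E)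
      \<and> finite_field_trace (2 ^ m) (k div m) w = 0"
    (is "?I \<longleftrightarrow> e \<noteq> 0 \<and> ?eq \<and> ?tr")
proof (cases "e = 0")
  case True
  then show ?thesis
    using discriminant_nonzero unfolding e_def by blast
next
  case e0: False
  obtain t where t: "t ^ Q = (A * cj C + B * cj E) / e"
    using Q_root by blast
  define s where "s = (A * cj B + C * cj E) / e"
  have ce: "cj e = e"
    by (simp add: e_def mult.commute)
  have cw: "cj w = w"
    by (simp add: w_def ce mult.commute)
  have *: "T (form A B C E x) (form A B C E y)
      = e * (T x y ^ Q * T x y) * (1 + w + rho t x y ^ Q + rho s x y)" if "T x y \<noteq> 0" for x y
    by (rule T_form_eq_rho) (use e0 that in \<open>simp_all add: e_def[symmetric] w_def t s_def\<close>)
  have I: "?I \<longleftrightarrow> avoids w t s"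
    unfolding projectively_injective_def avoids_def using * e0 by (auto simp: *)
  have "e ^ Q = e ^ (Q - 1) * e"
    by (metis Q_pos Suc_diff_1 power_Suc2)
  moreover have "(A * cj B + C * cj E) ^ Q = e ^ Q * s ^ Q" "A * cj C + B * cj E = e * t ^ Q"
    using e0 by (simp_all add: s_def t power_divide)
  ultimately have eq: "?eq \<longleftrightarrow> s = t"
    using e0 Q_inj[of s t] by (simp add: mult.assoc)
  have norm: "s * cj s + (t * cj t) ^ Q = w * w + w"
  proof -
    have "s * cj s + (t * cj t) ^ Q
      = ((A * cj B + C * cj E) * cj (A * cj B + C * cj E)
          + (A * cj C + B * cj E) * cj (A * cj C + B * cj E)) / (e * e)"
      unfolding power_mult_distrib cj_power[symmetric] t s_def cj_divide ce
      by (simp only: times_divide_times_eq add_divide_distrib[symmetric])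
    also have "\<dots> = w * w + w"
      unfolding pluecker e_def[symmetric] w_def using e0 by (simp add: field_simps)
    finally show ?thesis .
  qed
  then have av: "avoids w t s \<longleftrightarrow> t = s \<and> avoids w s s"
    using avoids_imp_eq[OF _ cw] by blast
  have "avoids w s s \<longleftrightarrow> ?tr" if "t = s"
  proof -
    have "w * w + w = (s * cj s) ^ Q + s * cj s"
      using norm that by (simp add: add.commute)
    then show ?thesis
      unfolding avoids_diag_iff using exists_phi_iff[OF m, of "s * cj s" w] by (simp add: mult.commute)
  qed
  then show ?thesis
    using e0 I eq av by blast
qed

lemma unit_circle_power_cong:
  assumes "z \<in> unit_circle" "[i = j] (mod (q + 1))" shows "z ^ i = z ^ j"
proof -
  have "z ^ i = z ^ (i mod (q + 1))" for i
  proof -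
    have "z ^ i = (z ^ (q + 1)) ^ (i div (q + 1)) * z ^ (i mod (q + 1))"
      unfolding power_mult[symmetric] power_add[symmetric] by (simp only: mult_div_mod_eq)
    then show ?thesis
      using assms(1) unfolding unit_circle_iff by (simp only: power_one mult_1)
  qed
  then show ?thesis
    using assms(2) by (metis cong_def)
qed

subsection \<open>Reduction of the polynomial to a twisted form\<close>

text \<open>For \<open>X = g * (y ^ Q * y)\<close> with \<open>g\<close> fixed and
  \<open>z = cj y / y\<close>, the quotient \<open>cj X / X\<close> is \<open>z ^ (Q + 1)\<close>.
  Its powers with exponents \<open>u\<close> and \<open>v\<close> are \<open>z\<close> and
  \<open>z ^ Q\<close>, so \<open>c\<close> and \<open>b\<close> become the middle
  coefficients.\<close>

lemma bij_iff_projectively_injective: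
  assumes u: "[u * (Q + 1) = 1] (mod (q + 1))" and v: "[v * (Q + 1) = Q] (mod (q + 1))"
    and P0: "P 0 = 0"
    and P: "\<And>X. X \<noteq> 0 \<Longrightarrow> P X = X * (1 + a * (cj X / X) + b * (cj X / X) ^ v + c * (cj X / X) ^ u)"
  shows "bij P \<longleftrightarrow> projectively_injective (form 1 c b a)"
proof -
  define F where "F = form 1 c b a"
  have circle: "cj y / y \<in> unit_circle" if "y \<noteq> 0" for y
    using that by (simp add: unit_circle_def)
  have circle_u: "z ^ (Q + 1) = z' \<Longrightarrow> z' ^ u = z" if "z \<in> unit_circle" for z z'
    using unit_circle_power_cong[OF that u] by (metis mult.commute power_mult power_one_right)
  have circle_v: "z ^ (Q + 1) = z' \<Longrightarrow> z' ^ v = z ^ Q" if "z \<in> unit_circle" for z z'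
    using unit_circle_power_cong[OF that v] by (metis mult.commute power_mult)
  have PF: "P (g * (y ^ Q * y)) = g * F y" if "cj g = g" "g \<noteq> 0" "y \<noteq> 0" for g y
  proof -
    define z X where "z = cj y / y" and "X = g * (y ^ Q * y)"
    have z: "z \<in> unit_circle"
      using circle that by (simp add: z_def)
    have zX: "z ^ (Q + 1) = cj X / X"
      using that by (simp add: z_def X_def power_divide mult.commute)
    have "X \<noteq> 0"
      using that by (simp add: X_def)
    from P[OF this] have "P X = X * (1 + a * z ^ (Q + 1) + b * z ^ Q + c * z)"
      by (simp only: circle_u[OF z zX] circle_v[OF z zX] zX)
    also have "\<dots> = g * F y"
      using that by (simp add: X_def z_def F_def form_def power_divide field_simps)
    finally show ?thesis
      unfolding X_def .
  qed
  have repr: "\<exists>g y. cj g = g \<and> g \<noteq> 0 \<and> y \<noteq> 0 \<and> X = g * (y ^ Q * y)" if "X \<noteq> 0" for X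
  proof -
    \<comment> \<open>With \<open>z * z = X / cj X\<close>, the quotient \<open>X / z\<close> is
      fixed by \<open>cj\<close>, and \<open>z ^ u\<close> serves as \<open>y\<close> because its
      power \<open>Q + 1\<close> is \<open>z\<close>.\<close>
    have "X / cj X \<in> unit_circle"
      using that by (simp add: unit_circle_def)
    then obtain z where z: "z \<in> unit_circle" "z * z = X / cj X"
      using unit_circle_sqrt by blast
    have "(z ^ u) ^ Q * z ^ u = z ^ (u * (Q + 1))"
      by (simp only: distrib_left mult_1_right power_add power_mult)
    also have "\<dots> = z"
      using unit_circle_power_cong[OF z(1) u] by simp
    finally have "X = (X / z) * ((z ^ u) ^ Q * z ^ u)"
      using unit_circleD(1)[OF z(1)] by simp
    moreover have "cj (X / z) = X / z"
    proof -
      have "X = z * z * cj X"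
        using z(2) that by simp
      then have "X / z = z * cj X"
        using unit_circleD(1)[OF z(1)] by (metis mult.assoc nonzero_mult_div_cancel_left)
      then show ?thesis
        by (simp add: unit_circleD(2)[OF z(1)] mult.commute)
    qed
    moreover have "X / z \<noteq> 0" "z ^ u \<noteq> 0"
      using that unit_circleD(1)[OF z(1)] by auto
    ultimately show ?thesis
      by blast
  qed
  have Phom: "P (g * X) = g * P X" if "cj g = g" "g \<noteq> 0" "X \<noteq> 0" for g X
    using that P[of X] P[of "g * X"] by simp
  show ?thesis
    unfolding F_def[symmetric]
  proof
    assume "bij P"
    then have inj: "P X = P Y \<Longrightarrow> X = Y" for X Y
      by (simp add: bij_def inj_def)
    have P_ne: "P X \<noteq> 0" if "X \<noteq> 0" for X
      using inj[of X 0] that by (auto simp: P0)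
    have PF1: "P (y ^ Q * y) = F y" if "y \<noteq> 0" for y
      using PF[of 1 y] that by simp
    show "projectively_injective F"
      unfolding projectively_injective_def
    proof safe
      fix x y assume nz: "T x y \<noteq> 0" and TF: "T (F x) (F y) = 0"
      have x0: "x \<noteq> 0" and y0: "y \<noteq> 0"
        using nz by (auto simp: T_def)
      have F_ne: "F x \<noteq> 0" "F y \<noteq> 0"
        using P_ne[of "x ^ Q * x"] P_ne[of "y ^ Q * y"] x0 y0 PF1 by auto
      \<comment> \<open>The vanishing of \<open>T (F x) (F y)\<close> puts \<open>g\<close> in the
        small field, so \<open>P\<close> can be compared at two explicit arguments.\<close>
      define g where "g = F x / F y"
      have cg: "cj g = g"
        using T_eq_0[OF TF F_ne(2)] by (simp add: g_def)
      have "P (x ^ Q * x) = P (g * (y ^ Q * y))"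
        using PF1[OF x0] PF[OF cg _ y0] F_ne by (simp add: g_def)
      then have g: "x ^ Q * x = g * (y ^ Q * y)"
        by (rule inj)
      define z where "z = (cj x / cj y) / (x / y)"
      have z: "z \<in> unit_circle"
        using circle[of "x / y"] x0 y0 by (simp add: z_def)
      have "cj x ^ Q * cj x = g * (cj y ^ Q * cj y)"
        using arg_cong[OF g, of cj] by (simp add: cg)
      then have "(cj x ^ Q * cj x) / (cj y ^ Q * cj y) = g" "(x ^ Q * x) / (y ^ Q * y) = g"
        using g y0 by simp_all
      moreover have "z ^ (Q + 1) = ((cj x ^ Q * cj x) / (cj y ^ Q * cj y)) / ((x ^ Q * x) / (y ^ Q * y))"
        by (simp add: z_def power_divide power_mult_distrib mult_ac)
      ultimately have "z ^ (Q + 1) = 1"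
        using F_ne by (simp add: g_def)
      then have "z = 1"
        using circle_u[OF z] by simp
      then have "cj x * y = x * cj y"
        using x0 y0 by (simp add: z_def field_simps)
      then show False
        using nz by (simp add: T_def)
    qed
  next
    assume pinj: "projectively_injective F"
    have F_ne: "F y \<noteq> 0" if "y \<noteq> 0" for y
      using T_nondegenerate[OF that] pinj unfolding projectively_injective_def
      by (metis T_def cj_0 mult_zero_right add_0_left)
    have P_ne: "P X \<noteq> 0" if "X \<noteq> 0" for X
      using repr[OF that] PF F_ne by force
    have "inj P"
    proof (rule injI)
      fix X Y assume PXY: "P X = P Y"
      show "X = Y"
      proof (cases "X = 0 \<or> Y = 0")
        case True
        then show ?thesis
          using PXY P_ne P0 by metis
      next
        case False
        then obtain g x h y where X: "cj g = g" "g \<noteq> 0" "x \<noteq> 0" "X = g * (x ^ Q * x)"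
          and Y: "cj h = h" "h \<noteq> 0" "y \<noteq> 0" "Y = h * (y ^ Q * y)"
          using repr by metis
        have eq: "g * F x = h * F y"
          using PXY PF X Y by simp
        have "g * cj (F x) = h * cj (F y)"
          using arg_cong[OF eq, of cj] X(1) Y(1) by simp
        then have "(g * F x) * (h * cj (F y)) = (g * cj (F x)) * (h * F y)"
          using eq by (simp add: mult_ac)
        then have "F x * cj (F y) = cj (F x) * F y"
          using X(2) Y(2) by (simp add: mult_ac)
        then have "T x y = 0"
          using pinj unfolding projectively_injective_def by (metis T_def add_self)
        then have c: "cj (x / y) = x / y"
          using Y(3) by (rule T_eq_0)
        \<comment> \<open>The ratio of \<open>X\<close> to \<open>Y\<close>; it lies in the small
          field, over which \<open>P\<close> is homogeneous.\<close>
        define j where "j = g / h * ((x / y) ^ Q * (x / y))"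
        have j: "cj j = j"
          unfolding j_def by (simp only: cj_mult cj_power cj_divide[of g h] c X(1) Y(1))
        have XjY: "j \<noteq> 0" "X = j * Y"
          using X Y unfolding j_def by (simp_all add: power_divide)
        then have "P X = j * P Y"
          using Phom[of j Y] j False by simp
        then have "j = 1"
          using PXY P_ne[of Y] False by simp
        then show ?thesis
          using XjY by simp
      qed
    qed
    then show "bij P"
      by (simp add: bij_def finite_UNIV_inj_surj)
  qed
qed

end

theorem corollary9p3:
  fixes k l m q Q u v :: nat
    and a b c e :: "'a :: {field, finite}"
    and A f :: "'a poly"
  assumes "k > 0" and "l > 0"
    and "m = 2 ^ multiplicity 2 (gcd k l)"
    and "q = 2 ^ k" and "Q = 2 ^ l"
    and "gcd (Q + 1) (q + 1) = 1"
    and "CARD('a) = q\<^sup>2"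
    and "u > 0" and "v > 0"
    and "[u * (Q + 1) = 1] (mod (q + 1))"
    and "[v * (Q + 1) = Q] (mod (q + 1))"
    and "A = 1 + monom a 1 + monom b v + monom c u"
    and "f = monom 1 1 * pcompose A (monom 1 (q - 1))"
    and "e = 1 + a ^ (q + 1) + b ^ (q + 1) + c ^ (q + 1)"
  shows "permutation_polynomial f \<longleftrightarrow>
           e \<noteq> 0
         \<and> (a ^ q * b + c ^ q) ^ Q = e ^ (Q - 1) * (a ^ q * c + b ^ q)
         \<and> finite_field_trace (2 ^ m) (k div m) ((b ^ (q + 1) + c ^ (q + 1)) / e) = 0"
proof -
  interpret quadratic_extension k l q Q "\<lambda>x :: 'a. x ^ q"
    using assms by unfold_locales (simp_all add: coprime_iff_gcd_eq_1)
  have m: "m > 0" "m dvd k" "m dvd l"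
    using multiplicity_dvd[of 2 "gcd k l"] unfolding assms(3) by auto
  \<comment> \<open>Both even contradicts the maximality of the power of two in \<open>m\<close>;
    both odd gives \<open>q + 1\<close> and \<open>Q + 1\<close> the common factor
    \<open>2 ^ m + 1\<close>.\<close>
  have odd: "odd (k div m + l div m)"
  proof -
    have "\<not> (even (k div m) \<and> even (l div m))"
    proof safe
      assume "even (k div m)" "even (l div m)"
      then have "m * 2 dvd k" "m * 2 dvd l"
        using m by (metis dvd_mult_div_cancel mult_dvd_mono dvd_refl)+
      then have "2 ^ Suc (multiplicity 2 (gcd k l)) dvd gcd k l"
        by (simp add: assms(3) mult.commute)
      then have "Suc (multiplicity 2 (gcd k l)) \<le> multiplicity 2 (gcd k l)"
        using assms(1) by (intro multiplicity_geI) auto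
      then show False
        by simp
    qed
    moreover have "\<not> (odd (k div m) \<and> odd (l div m))"
    proof safe
      assume o: "odd (k div m)" "odd (l div m)"
      have "q = (2 ^ m) ^ (k div m)" "Q = (2 ^ m) ^ (l div m)"
        using m by (simp_all add: assms(4,5) flip: power_mult)
      then have "2 ^ m + 1 dvd q + 1" "2 ^ m + 1 dvd Q + 1"
        using one_plus_power_dvd[OF o(1), of "2 ^ m"] one_plus_power_dvd[OF o(2), of "2 ^ m"] by simp_all
      then have "2 ^ m + 1 dvd (1 :: nat)"
        using assms(6) by (metis gcd_greatest)
      then show False
        by simp
    qed
    ultimately show ?thesis
      by auto
  qed
  have q1: "q - 1 \<noteq> 0" "Suc (q - 1) = q"
    using q_ge_2 by auto
  have P: "poly f X = X * (1 + a * (X ^ q / X) + b * (X ^ q / X) ^ v + c * (X ^ q / X) ^ u)"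
    if "X \<noteq> 0" for X
  proof -
    have "X ^ q = X ^ (q - 1) * X"
      by (metis q1(2) power_Suc2)
    then have "X ^ (q - 1) = X ^ q / X"
      using that by simp
    then show ?thesis
      by (simp add: assms(12,13) poly_pcompose poly_monom)
  qed
  have "poly f 0 = 0"
    by (simp add: assms(13) poly_monom)
  with P have "bij (poly f) \<longleftrightarrow> projectively_injective (form 1 c b a)"
    using assms by (intro bij_iff_projectively_injective[of u v]) auto
  also have "\<dots> \<longleftrightarrow> e \<noteq> 0 \<and> (a ^ q * b + c ^ q) ^ Q = e ^ (Q - 1) * (a ^ q * c + b ^ q)
      \<and> finite_field_trace (2 ^ m) (k div m) ((b ^ (q + 1) + c ^ (q + 1)) / e) = 0"
    unfolding projectively_injective_form_iff[OF m odd] by (simp add: assms(14) add_ac mult_ac)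
  finally show ?thesis
    unfolding permutation_polynomial_def .
qed

end
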